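(* Let $N\ge2$, $1\le p<\infty$, let $T_1=T_{f_1,w_1},\dots,T_N=T_{f_N,w_N}$ be unilateral pseudo-shifts on $\ell^p(\mathbb{N})$, and let $\mathcal{A}=\mathcal{A}_{uBd}$ or $\mathcal{A}=\mathcal{A}_{ud}$. If $\mathcal{A}$ is $(f_s)_{s=1}^N$-almost partition regular, then $T_1,\dots,T_N$ are disjoint $\mathcal{A}$-hypercyclic if and only if: (1) for any $j\ge1$ and any $s\in[N]$, $\sum_{n\ge1}\frac{1}{|W^s_{j,n}|^p}<\infty$; (2) for any $l\ge1$, any scalars $(a_{s,j})_{s\in[N],j\in[l]}$ with all $a_{s,j}\ne0$, and any $\varepsilon>0$, there exists $A\in\mathcal{A}$ such that for any $s\ne t\in[N]$ and any $n\in A$: (a) for any $1\le j\le l$, $\displaystyle\sum_{m\in A:\ f_t^m(j)\in f_s^n((l,+\infty))}\frac{|W^s_{f_s^{-n}(f_t^m(j)),n}|^p}{|W^t_{j,m}|^p}\le\varepsilon$; (b) for any $j\in f_t^n([l])\cap f_s^n([l])$, $\displaystyle\left|\frac{W^s_{f_s^{-n}(j),n}}{W^t_{f_t^{-n}(j),n}}-\frac{a_{s,f_s^{-n}(j)}}{a_{t,f_t^{-n}(j)}}\right|\le\varepsilon$. Here $W^s_{l,n}=\prod_{\nu=1}^nw_{s,f_s^\nu(l)}$ for all $s\in[N]$.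
   Context: $\mathbb{N}=\{1,2,\dots\}$, $[l]=\{1,\dots,l\}$, $(l,\infty)$ denotes the integers $>l$; spaces are over $\mathbb{K}=\mathbb{R}$ or $\mathbb{C}$ with canonical basis $(e_j)_{j\ge1}$. $f^n$ is the $n$-th iterate of $f$ and, for injective $f$, $f^{-n}$ is the inverse of $f^n$ on its range. Pseudo-shift: for a bounded weight sequence of scalars $w=(w_j)_{j\in\mathbb{N}}$ and a strictly increasing $f:\mathbb{N}\to\mathbb{N}$ with $f(1)>1$, $T_{f,w}\big(\sum_{j\ge1}x_je_j\big)=\sum_{j\ge1}w_{f(j)}x_{f(j)}e_j$. We write $w_s=(w_{s,j})_{j\in\mathbb{N}}$. For $A\subset\mathbb{N}$: $\overline{\mathrm{dens}}\,A=\limsup_{M\to\infty}\frac{\mathrm{card}\{n\le M:n\in A\}}{M}$, $\overline{\mathrm{Bd}}\,A=\limsup_{M\to\infty}\max_{k\ge1}\frac{\mathrm{card}(A\cap\{k+1,\dots,k+M\})}{M}$. $\mathcal{A}_{uBd}$ and $\mathcal{A}_{ud}$ are the families of subsets of $\mathbb{N}$ of positive upper Banach density and positive upper density, respectively. $T_1,\dots,T_N$ are disjoint $\mathcal{A}$-hypercyclic if there is $x\in X$ (here $X=\ell^p(\mathbb{N})$) such that for all non-empty open $V_1,\dots,V_N\subset X$, $\{n:T_s^nx\in V_s\text{ for all }s\in[N]\}\in\mathcal{A}$. $\mathcal{A}$ is $(f_s)_{s=1}^N$-almost partition regular if for any $l\ge1$ and any $B\in\mathcal{A}$ there exists $A\subseteq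 B$ with $A\in\mathcal{A}$ such that $f_s^m([l])\cap f_t^n([l])=\emptyset$ for all $m,n\in A$ with $m\ne n$ and all $s,t\in[N]$. Convention: $1/0=+\infty$, so condition (1) includes the requirement that all $W^s_{j,n}$ are nonzero. *)

theory Defs
  imports "HOL-Analysis.Analysis"
begin

text \<open>
  The set of positive integers is rendered as the subset \<open>{1..}\<close> of \<^typ>\<open>nat\<close>, and \<open>[l]\<close> as \<open>{1..l}\<close>.
  The scalar field is a type \<open>'k\<close> of sort \<open>{real_normed_field, euclidean_space}\<close>; \<^typ>\<open>real\<close> and
  \<^typ>\<open>complex\<close> are instances, and up to isomorphism they are the only commutative
  real normed fields.
\<close>

text \<open>
  Sequences indexed by \<open>{1..}\<close> are functions on \<^typ>\<open>nat\<close> that vanish at the unused index \<open>0\<close>, so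
  that equality of functions is equality of sequences and the term at \<open>0\<close> does not contribute
  to the norm.
\<close>

definition lp_space :: "real \<Rightarrow> (nat \<Rightarrow> 'k::real_normed_vector) set" where
  "lp_space p = {x. x 0 = 0 \<and> summable (\<lambda>j. norm (x j) powr p)}"

definition lp_norm :: "real \<Rightarrow> (nat \<Rightarrow> 'k::real_normed_vector) \<Rightarrow> real" where
  "lp_norm p x = (\<Sum>j. norm (x j) powr p) powr (1 / p)"

definition lp_dist :: "real \<Rightarrow> (nat \<Rightarrow> 'k::real_normed_vector) \<Rightarrow> (nat \<Rightarrow> 'k) \<Rightarrow> real" where
  "lp_dist p x y = lp_norm p (\<lambda>j. x j - y j)"

abbreviation lp_topology :: "real \<Rightarrow> (nat \<Rightarrow> 'k::real_normed_vector) topology" where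
  "lp_topology p \<equiv> Metric_space.mtopology (lp_space p) (lp_dist p)"

lemma convex_powr_nonneg:
  fixes u v t p :: real
  assumes "1 \<le> p" "0 \<le> u" "0 \<le> v" "0 \<le> t" "t \<le> 1"
  shows "(t * u + (1 - t) * v) powr p \<le> t * u powr p + (1 - t) * v powr p"
proof -
  have shrink: "(s * c) powr p \<le> s * c powr p" if "0 \<le> s" "s \<le> 1" "0 \<le> c" for s c :: real
  proof (cases "s = 0")
    case False
    have "s powr p \<le> s powr 1"
      using that assms(1) False by (intro powr_mono') auto
    then show ?thesis
      using that False by (simp add: powr_mult mult_right_mono)
  qed simp
  consider "u = 0" | "v = 0" | "0 < u" "0 < v"
    using assms by linarith
  then show ?thesis
  proof cases
    case 3
    then show ?thesis
      using convex_onD[OF powr_convex[OF assms(1)], of "1 - t" u v] assms by simp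
  next
    case 1
    then show ?thesis using shrink[of "1 - t" v] assms by simp
  next
    case 2
    then show ?thesis using shrink[of t u] assms by simp
  qed
qed

lemma lp_norm_nonneg [simp]: "0 \<le> lp_norm p x"
  by (simp add: lp_norm_def)

lemma lp_norm_powr:
  assumes "1 \<le> p" "x \<in> lp_space p"
  shows "lp_norm p x powr p = (\<Sum>j. norm (x j) powr p)"
  using assms by (simp add: lp_norm_def lp_space_def powr_powr suminf_nonneg)

lemma lp_norm_eq_0_iff:
  assumes "1 \<le> p" "x \<in> lp_space p"
  shows "lp_norm p x = 0 \<longleftrightarrow> (\<forall>j. x j = 0)"
proof -
  have "lp_norm p x = 0 \<longleftrightarrow> (\<Sum>j. norm (x j) powr p) = 0"
    by (simp add: lp_norm_def)
  also have "\<dots> \<longleftrightarrow> (\<forall>j. norm (x j) powr p = 0)"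
    using assms by (intro suminf_eq_zero_iff) (auto simp: lp_space_def)
  finally show ?thesis by simp
qed

lemma lp_minkowski:
  fixes x y :: "nat \<Rightarrow> 'k::real_normed_vector"
  assumes p: "1 \<le> p" and x: "x \<in> lp_space p" and y: "y \<in> lp_space p"
  shows "(\<lambda>j. x j + y j) \<in> lp_space p"
    and "lp_norm p (\<lambda>j. x j + y j) \<le> lp_norm p x + lp_norm p y"
proof -
  define A where "A = lp_norm p x"
  define B where "B = lp_norm p y"
  have AB: "0 \<le> A" "0 \<le> B" by (simp_all add: A_def B_def)
  have sx: "summable (\<lambda>j. norm (x j) powr p)" and sy: "summable (\<lambda>j. norm (y j) powr p)"
    and x0: "x 0 = 0" and y0: "y 0 = 0"
    using x y by (auto simp: lp_space_def)
  have "(\<lambda>j. x j + y j) \<in> lp_space p \<and> lp_norm p (\<lambda>j. x j + y j) \<le> A + B"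
  proof (cases "A = 0 \<or> B = 0")
    case True
    then have "(\<forall>j. x j = 0) \<or> (\<forall>j. y j = 0)"
      using lp_norm_eq_0_iff[OF p x] lp_norm_eq_0_iff[OF p y] by (auto simp: A_def B_def)
    then show ?thesis
    proof
      assume "\<forall>j. x j = 0"
      then show ?thesis using y AB by (simp add: B_def)
    next
      assume "\<forall>j. y j = 0"
      then show ?thesis using x AB by (simp add: A_def)
    qed
  next
    case False
    then have pos: "0 < A" "0 < B" using AB by auto
    define t where "t = A / (A + B)"
    have t: "0 \<le> t" "t \<le> 1" "1 - t = B / (A + B)"
      using pos by (auto simp: t_def field_simps)
    define g where "g j = (A + B) powr p *
        (t * (norm (x j) powr p / A powr p) + (1 - t) * (norm (y j) powr p / B powr p))" for j
    have le: "norm (x j + y j) powr p \<le> g j" for j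
    proof -
      define u where "u = norm (x j) / A"
      define v where "v = norm (y j) / B"
      have uv: "0 \<le> u" "0 \<le> v" using AB by (auto simp: u_def v_def)
      have "norm (x j) + norm (y j) = (A + B) * (t * u + (1 - t) * v)"
        unfolding t(3) using pos
        by (simp add: t_def u_def v_def distrib_left)
      then have "norm (x j + y j) \<le> (A + B) * (t * u + (1 - t) * v)"
        using norm_triangle_ineq[of "x j" "y j"] by linarith
      then have "norm (x j + y j) powr p \<le> ((A + B) * (t * u + (1 - t) * v)) powr p"
        using p by (intro powr_mono2) auto
      also have "\<dots> = (A + B) powr p * (t * u + (1 - t) * v) powr p"
        using pos uv t by (intro powr_mult) 
      also have "\<dots> \<le> (A + B) powr p * (t * u powr p + (1 - t) * v powr p)"
        using p uv t by (intro mult_left_mono convex_powr_nonneg) auto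
      also have "\<dots> = g j"
        using pos by (simp add: g_def u_def v_def powr_divide)
      finally show ?thesis .
    qed
    have sxA: "(\<lambda>j. norm (x j) powr p) sums (A powr p)"
      using sx lp_norm_powr[OF p x] by (simp add: A_def summable_sums)
    have syB: "(\<lambda>j. norm (y j) powr p) sums (B powr p)"
      using sy lp_norm_powr[OF p y] by (simp add: B_def summable_sums)
    have "g sums ((A + B) powr p * (t * (A powr p / A powr p) + (1 - t) * (B powr p / B powr p)))"
      unfolding g_def by (intro sums_mult sums_add sums_divide sxA syB)
    then have g: "g sums ((A + B) powr p)" using pos by simp
    have s: "summable (\<lambda>j. norm (x j + y j) powr p)"
      by (rule summable_comparison_test'[OF sums_summable[OF g], of 0]) (use le in auto)
    have "(\<Sum>j. norm (x j + y j) powr p) \<le> (A + B) powr p"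
      using suminf_le[OF le s sums_summable[OF g]] g by (simp add: sums_iff)
    then have "lp_norm p (\<lambda>j. x j + y j) \<le> ((A + B) powr p) powr (1 / p)"
      unfolding lp_norm_def using p s by (intro powr_mono2 suminf_nonneg) auto
    also have "\<dots> = A + B" using pos p by (simp add: powr_powr)
    finally show ?thesis using s x0 y0 by (simp add: lp_space_def)
  qed
  then show "(\<lambda>j. x j + y j) \<in> lp_space p"
    and "lp_norm p (\<lambda>j. x j + y j) \<le> lp_norm p x + lp_norm p y"
    by (auto simp: A_def B_def)
qed

lemma lp_diff_mem:
  assumes "1 \<le> p" "x \<in> lp_space p" "y \<in> lp_space p"
  shows "(\<lambda>j. x j - y j) \<in> lp_space p"
  using lp_minkowski(1)[of p x "\<lambda>j. - y j"] assms by (simp add: lp_space_def)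

lemma Metric_space_lp:
  assumes p: "1 \<le> p"
  shows "Metric_space (lp_space p :: (nat \<Rightarrow> 'k::real_normed_vector) set) (lp_dist p)"
proof
  fix x y z :: "nat \<Rightarrow> 'k"
  show "0 \<le> lp_dist p x y" by (simp add: lp_dist_def)
  show "lp_dist p x y = lp_dist p y x" by (simp add: lp_dist_def lp_norm_def norm_minus_commute)
  show "lp_dist p x y = 0 \<longleftrightarrow> x = y" if "x \<in> lp_space p" "y \<in> lp_space p"
    using lp_norm_eq_0_iff[OF p lp_diff_mem[OF p that]] by (auto simp: lp_dist_def)
  show "lp_dist p x z \<le> lp_dist p x y + lp_dist p y z"
    if "x \<in> lp_space p" "y \<in> lp_space p" "z \<in> lp_space p"
    using lp_minkowski(2)[OF p lp_diff_mem[OF p that(1,2)] lp_diff_mem[OF p that(2,3)]]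
    by (simp add: lp_dist_def)
qed

definition pseudo_shift_data :: "(nat \<Rightarrow> nat) \<Rightarrow> (nat \<Rightarrow> 'k::real_normed_vector) \<Rightarrow> bool" where
  "pseudo_shift_data f w \<longleftrightarrow> strict_mono_on {1..} f \<and> f 1 > 1 \<and> bounded (w ` {1..})"

definition pseudo_shift ::
    "(nat \<Rightarrow> nat) \<Rightarrow> (nat \<Rightarrow> 'k::real_normed_field) \<Rightarrow> (nat \<Rightarrow> 'k) \<Rightarrow> (nat \<Rightarrow> 'k)" where
  "pseudo_shift f w x = (\<lambda>j. if j \<ge> 1 then w (f j) * x (f j) else 0)"

definition weight_prod :: "(nat \<Rightarrow> nat) \<Rightarrow> (nat \<Rightarrow> 'k::real_normed_field) \<Rightarrow> nat \<Rightarrow> nat \<Rightarrow> 'k" where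
  "weight_prod f w l n = (\<Prod>\<nu>=1..n. w ((f ^^ \<nu>) l))"

text \<open>\<open>f\<^sup>-\<^sup>n\<close> on the range of \<open>f\<^sup>n\<close>, as a self-map of \<open>{1..}\<close>:\<close>

definition iter_inv :: "(nat \<Rightarrow> nat) \<Rightarrow> nat \<Rightarrow> nat \<Rightarrow> nat" where
  "iter_inv f n = inv_into {1..} (f ^^ n)"

lemma pseudo_shift_mem_lp:
  assumes fw: "pseudo_shift_data f w" and p: "1 \<le> p" and x: "x \<in> lp_space p"
  shows "pseudo_shift f w x \<in> lp_space p"
proof -
  have mono: "strict_mono_on {1..} f" and f1: "f 1 > 1"
    using fw by (auto simp: pseudo_shift_data_def)
  obtain C where C: "\<And>j. j \<ge> 1 \<Longrightarrow> norm (w j) \<le> C"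
    using fw by (auto simp: pseudo_shift_data_def bounded_iff)
  have ge1: "f (Suc j) \<ge> 1" for j
    using strict_mono_onD[OF mono, of 1 "Suc j"] f1 by (cases "j = 0") auto
  have inj: "strict_mono (\<lambda>j. f (Suc j))"
    using mono by (auto simp: strict_mono_def strict_mono_on_def)
  have sx: "summable (\<lambda>j. norm (x j) powr p)" using x by (simp add: lp_space_def)
  have "summable (\<lambda>j. norm (x (f (Suc j))) powr p)"
    using summable_reindex[OF sx strict_mono_imp_inj_on[OF inj]] by (simp add: o_def)
  then have s: "summable (\<lambda>j. C powr p * norm (x (f (Suc j))) powr p)"
    by (rule summable_mult)
  have "summable (\<lambda>j. norm (pseudo_shift f w x (Suc j)) powr p)"
  proof (rule summable_comparison_test'[OF s, of 0])
    fix j :: nat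
    have "norm (w (f (Suc j)) * x (f (Suc j))) powr p \<le> C powr p * norm (x (f (Suc j))) powr p"
      using C[OF ge1[of j]] p by (simp add: norm_mult powr_mult powr_mono2 mult_right_mono)
    then show "norm (norm (pseudo_shift f w x (Suc j)) powr p)
        \<le> C powr p * norm (x (f (Suc j))) powr p"
      by (simp add: pseudo_shift_def)
  qed
  then have "summable (\<lambda>j. norm (pseudo_shift f w x j) powr p)"
    by (subst (asm) summable_Suc_iff)
  then show ?thesis
    by (simp add: lp_space_def pseudo_shift_def)
qed

definition upper_density :: "nat set \<Rightarrow> ereal" where
  "upper_density A = limsup (\<lambda>M. ereal (real (card (A \<inter> {1..M})) / real M))"

definition upper_Banach_density :: "nat set \<Rightarrow> ereal" where
  "upper_Banach_density A =
     limsup (\<lambda>M. ereal (real (MAX k\<in>{1..}. card (A \<inter> {k+1..k+M})) / real M))"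

text \<open>The maximum over the infinite range of \<open>k\<close> is taken over a finite set of values:\<close>

lemma finite_window_cards: "finite ((\<lambda>k. card (A \<inter> {k+1..k+M})) ` {1::nat..})"
proof (rule finite_subset)
  show "(\<lambda>k. card (A \<inter> {k+1..k+M})) ` {1..} \<subseteq> {..M}"
  proof (clarsimp)
    fix k
    have "card (A \<inter> {Suc k..k+M}) \<le> card {Suc k..k+M}" by (intro card_mono) auto
    then show "card (A \<inter> {Suc k..k+M}) \<le> M" by simp
  qed
qed simp

definition family_ud :: "nat set set" where
  "family_ud = {A. A \<subseteq> {1..} \<and> 0 < upper_density A}"

definition family_uBd :: "nat set set" where
  "family_uBd = {A. A \<subseteq> {1..} \<and> 0 < upper_Banach_density A}"

definition disjoint_hypercyclic ::
    "'b topology \<Rightarrow> nat set set \<Rightarrow> nat \<Rightarrow> (nat \<Rightarrow> 'b \<Rightarrow> 'b) \<Rightarrow> bool" where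
  "disjoint_hypercyclic X \<A> N T \<longleftrightarrow>
     (\<exists>x\<in>topspace X. \<forall>V. (\<forall>s\<in>{1..N}. openin X (V s) \<and> V s \<noteq> {}) \<longrightarrow>
        {n. n \<ge> 1 \<and> (\<forall>s\<in>{1..N}. (T s ^^ n) x \<in> V s)} \<in> \<A>)"

definition almost_partition_regular ::
    "nat set set \<Rightarrow> nat \<Rightarrow> (nat \<Rightarrow> nat \<Rightarrow> nat) \<Rightarrow> bool" where
  "almost_partition_regular \<A> N f \<longleftrightarrow>
     (\<forall>l\<ge>1. \<forall>B\<in>\<A>. \<exists>A\<subseteq>B. A \<in> \<A> \<and>
        (\<forall>m\<in>A. \<forall>n\<in>A. m \<noteq> n \<longrightarrow>
           (\<forall>s\<in>{1..N}. \<forall>t\<in>{1..N}. (f s ^^ m) ` {1..l} \<inter> (f t ^^ n) ` {1..l} = {})))"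

end

theory Submission
  imports Defs
begin

text \<open>
  Write \<open>W\<^sup>s\<^sub>j\<^sub>,\<^sub>n\<close> for the weight products, so that \<open>T\<^sub>s\<^sup>n x\<close> has the entry \<open>W\<^sup>s\<^sub>k\<^sub>,\<^sub>n x (f\<^sub>s\<^sup>n k)\<close> at \<open>k\<close>, and recall the
  cocycle identity \<open>W\<^sup>s\<^sub>j\<^sub>,\<^sub>m = W\<^sup>s\<^sub>j\<^sub>,\<^sub>m\<^sub>-\<^sub>n W\<^sup>s\<^sub>k\<^sub>,\<^sub>n\<close> for \<open>k = f\<^sub>s\<^sup>m\<^sup>-\<^sup>n j\<close>.

  Necessity. Let \<open>A\<close> be the set of common return times of a disjoint hypercyclic vector \<open>x\<close> to small balls around
  vectors supported on \<open>[l]\<close> with the entries \<open>a\<^sub>s\<^sub>,\<^sub>j\<close>. For \<open>m \<in> A\<close> and \<open>j \<le> l\<close> the number \<open>x (f\<^sub>t\<^sup>m j)\<close> is close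
  to \<open>a\<^sub>t\<^sub>,\<^sub>j / W\<^sup>t\<^sub>j\<^sub>,\<^sub>m\<close>, and condition (2) follows by comparing the entries of \<open>T\<^sub>s\<^sup>n x\<close>, \<open>n \<in> A\<close>, inside and
  outside \<open>[l]\<close> with their targets (\<open>weight_conditions_of_returns\<close>). The same comparison with \<open>s = t\<close> bounds the
  sums of \<open>1 / \<bar>W\<^sup>s\<^sub>j\<^sub>,\<^sub>m\<^sub>-\<^sub>n\<bar>\<^sup>p\<close> over \<open>m \<in> A\<close>, \<open>m > n\<close>, uniformly in \<open>n \<in> A\<close>. Condition (1) asks for the sum over
  all integers instead of differences of \<open>A\<close>. The link is that a set of positive upper Banach density becomes, after
  thickening by a bounded amount, so dense in long windows that every natural number is a difference of many pairs of its
  elements (\<open>Banach_dense_thickening\<close>, \<open>bounded_sums_of_Banach_dense_differences\<close>); the thickening costs only a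
  constant factor because the weights are bounded.

  Sufficiency. By the Baire category theorem in \<open>\<ell>\<^sup>p\<close> it is enough to find, for each of countably many targets, a
  \<open>\<delta> > 0\<close> such that densely many vectors return to the target along long windows with density above \<open>\<delta>\<close>
  (\<open>disjoint_hypercyclic_of_uniform_return_density\<close>). Given a target with entries \<open>y\<^sub>s\<^sub>,\<^sub>j\<close>, let \<open>A\<close> come from (2) with
  \<open>a = y\<close>. Almost partition regularity allows \<open>A\<close> to be thinned so that the blocks \<open>f\<^sub>s\<^sup>m [l]\<close>, \<open>m \<in> A\<close>, do not collide and
  so that \<open>A\<close> has large gaps (\<open>large_gaps_of_disjoint_blocks\<close>). A vector with the entries \<open>y\<^sub>t\<^sub>,\<^sub>j / W\<^sup>t\<^sub>j\<^sub>,\<^sub>m\<close> at \<open>f\<^sub>t\<^sup>m j\<close>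
  for late \<open>m \<in> A\<close> is then a small perturbation of any given finitely supported vector by (1), and it returns to
  the target at each of these \<open>m\<close>: interference between different operators is controlled by (2), interference of
  an operator with itself by the tails of (1), thanks to the gaps (\<open>interpolating_vector\<close>). Since \<open>A\<close> depends only
  on the target, so does \<open>\<delta>\<close> (\<open>uniform_return_density\<close>).
\<close>

section \<open>Finite sums and the norm of \<open>\<ell>\<^sup>p\<close>\<close>

text \<open>
  All infinite sums, in the extended sense of the two conditions and in the norm, are handled through uniform
  bounds on their finite partial sums, which can be reindexed and split freely.
\<close>

lemma infsum_ennreal_le_iff:
  fixes g :: "'a \<Rightarrow> ennreal"
  shows "(\<Sum>\<^sub>\<infinity>x\<in>A. g x) \<le> b \<longleftrightarrow> (\<forall>F. finite F \<longrightarrow> F \<subseteq> A \<longrightarrow> sum g F \<le> b)"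
  by (subst nonneg_infsum_complete) (auto simp: SUP_le_iff)

lemma infsum_ennreal_quotient_le_iff:
  assumes "\<And>m. m \<in> A \<Longrightarrow> 0 \<le> u m" and "\<And>m. m \<in> A \<Longrightarrow> 0 < v m" and "0 \<le> b"
  shows "(\<Sum>\<^sub>\<infinity>m\<in>A. ennreal (u m) / ennreal (v m)) \<le> ennreal b
    \<longleftrightarrow> (\<forall>F. finite F \<longrightarrow> F \<subseteq> A \<longrightarrow> (\<Sum>m\<in>F. u m / v m) \<le> b)"
proof -
  have "(\<Sum>m\<in>F. ennreal (u m) / ennreal (v m)) = ennreal (\<Sum>m\<in>F. u m / v m)" if "F \<subseteq> A" for F
  proof -
    have "(\<Sum>m\<in>F. ennreal (u m) / ennreal (v m)) = (\<Sum>m\<in>F. ennreal (u m / v m))"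
      using assms that by (intro sum.cong refl divide_ennreal) auto
    also have "\<dots> = ennreal (\<Sum>m\<in>F. u m / v m)"
      using assms that by (intro sum_ennreal) (meson divide_nonneg_pos subsetD)
    finally show ?thesis .
  qed
  then show ?thesis
    using assms(3) by (simp add: infsum_ennreal_le_iff)
qed

text \<open>The convention \<open>1 / 0 = \<infinity>\<close> is what makes a finite value exclude zero denominators.\<close>

lemma infsum_ennreal_inverse_finite_iff:
  fixes g :: "'a \<Rightarrow> real"
  assumes "\<And>n. n \<in> A \<Longrightarrow> 0 \<le> g n"
  shows "(\<Sum>\<^sub>\<infinity>n\<in>A. 1 / ennreal (g n)) < \<infinity> \<longleftrightarrow>
    (\<forall>n\<in>A. 0 < g n) \<and> (\<exists>C\<ge>0. \<forall>F. finite F \<longrightarrow> F \<subseteq> A \<longrightarrow> (\<Sum>n\<in>F. 1 / g n) \<le> C)"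
    (is "?l < _ \<longleftrightarrow> ?pos \<and> ?bdd")
proof
  assume fin: "?l < \<infinity>"
  have pos: ?pos
  proof (rule ballI, rule ccontr)
    fix n assume n: "n \<in> A" "\<not> 0 < g n"
    then have "1 / ennreal (g n) = \<infinity>" by (simp add: ennreal_neg)
    moreover have "sum (\<lambda>n. 1 / ennreal (g n)) {n} \<le> ?l"
      using n infsum_ennreal_le_iff[of "\<lambda>n. 1 / ennreal (g n)" A ?l]
      by (metis bot.extremum finite.emptyI finite.insertI insert_subset order_refl)
    ultimately show False using fin by simp
  qed
  obtain C where C: "?l = ennreal C" "0 \<le> C"
    using fin by (cases ?l) auto
  have "(\<Sum>\<^sub>\<infinity>n\<in>A. ennreal 1 / ennreal (g n)) \<le> ennreal C"
    using C by simp
  then have "\<forall>F. finite F \<longrightarrow> F \<subseteq> A \<longrightarrow> (\<Sum>n\<in>F. 1 / g n) \<le> C"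
    using pos C by (subst (asm) infsum_ennreal_quotient_le_iff) auto
  then show "?pos \<and> ?bdd" using pos C by blast
next
  assume R: "?pos \<and> ?bdd"
  then obtain C where C: "0 \<le> C" "\<forall>F. finite F \<longrightarrow> F \<subseteq> A \<longrightarrow> (\<Sum>n\<in>F. 1 / g n) \<le> C" by blast
  then have "(\<Sum>\<^sub>\<infinity>n\<in>A. ennreal 1 / ennreal (g n)) \<le> ennreal C"
    using R by (subst infsum_ennreal_quotient_le_iff) auto
  then have "?l \<le> ennreal C" by simp
  also have "\<dots> < \<infinity>" by simp
  finally show "?l < \<infinity>" .
qed

lemma finite_sum_le_lp_norm:
  assumes "1 \<le> p" "x \<in> lp_space p" "finite F"
  shows "(\<Sum>j\<in>F. norm (x j) powr p) \<le> lp_norm p x powr p"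
  using assms sum_le_suminf[of "\<lambda>j. norm (x j) powr p" F]
  by (simp add: lp_norm_powr lp_space_def)

lemma lp_boundI:
  assumes p: "1 \<le> p" and "x 0 = 0" "0 \<le> r"
    and le: "\<And>F. finite F \<Longrightarrow> (\<Sum>j\<in>F. norm (x j) powr p) \<le> r powr p"
  shows "x \<in> lp_space p" "lp_norm p x \<le> r"
proof -
  have s: "summable (\<lambda>j. norm (x j) powr p)"
    by (rule summableI_nonneg_bounded[where x = "r powr p"]) (auto intro: le)
  then show "x \<in> lp_space p" using assms by (simp add: lp_space_def)
  have "(\<Sum>j. norm (x j) powr p) \<le> r powr p"
    using s by (intro suminf_le_const le) auto
  then have "(\<Sum>j. norm (x j) powr p) powr (1/p) \<le> (r powr p) powr (1/p)"
    using p s by (intro powr_mono2 suminf_nonneg) auto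
  then show "lp_norm p x \<le> r"
    using assms by (simp add: lp_norm_def powr_powr)
qed

lemma norm_coord_le_lp_norm:
  assumes p: "1 \<le> p" and x: "x \<in> lp_space p"
  shows "norm (x j) \<le> lp_norm p x"
proof -
  have "norm (x j) powr p \<le> lp_norm p x powr p"
    using finite_sum_le_lp_norm[OF p x, of "{j}"] by simp
  then show ?thesis
    using p powr_less_mono2[of p "lp_norm p x" "norm (x j)"] by fastforce
qed

lemma finitely_supported_lp_space:
  assumes "x 0 = 0" "finite {j. x j \<noteq> 0}"
  shows "x \<in> lp_space p"
  using assms
  by (auto simp: lp_space_def intro!: summable_finite[of "{j. x j \<noteq> 0}"])

lemma summable_tail_small:
  fixes c :: "nat \<Rightarrow> real"
  assumes s: "summable c" and nonneg: "\<And>n. 0 \<le> c n" and "0 < e"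
  shows "\<exists>L. \<forall>F. finite F \<longrightarrow> F \<subseteq> {L<..} \<longrightarrow> sum c F < e"
proof -
  obtain L where L: "\<And>n. L \<le> n \<Longrightarrow> norm (\<Sum>j. c (j + n)) < e"
    using suminf_exist_split[OF \<open>0 < e\<close> s] by blast
  show ?thesis
  proof (intro exI allI impI)
    fix F :: "nat set" assume F: "finite F" "F \<subseteq> {L<..}"
    have "sum c F = (\<Sum>j\<in>(\<lambda>j. j - L) ` F. c (j + L))"
      by (rule sum.reindex_bij_witness[of _ "\<lambda>j. j + L" "\<lambda>j. j - L"]) (use F in force)+
    also have "\<dots> \<le> (\<Sum>j. c (j + L))"
      using F nonneg summable_ignore_initial_segment[OF s, of L] by (intro sum_le_suminf) auto
    also have "\<dots> < e" using L[of L] by simp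
    finally show "sum c F < e" .
  qed
qed

lemma mcomplete_lp:
  assumes p: "1 \<le> p"
  shows "Metric_space.mcomplete (lp_space p :: (nat \<Rightarrow> 'k::{real_normed_vector,complete_space}) set) (lp_dist p)"
proof -
  interpret Metric_space "lp_space p :: (nat \<Rightarrow> 'k) set" "lp_dist p"
    by (rule Metric_space_lp[OF p])
  show ?thesis
    unfolding mcomplete_def
  proof (intro allI impI)
    fix \<sigma> :: "nat \<Rightarrow> nat \<Rightarrow> 'k"
    assume "MCauchy \<sigma>"
    then have mem: "\<sigma> n \<in> lp_space p" for n
      by (auto simp: MCauchy_def)
    have cau: "\<exists>M. \<forall>n n'. M \<le> n \<longrightarrow> M \<le> n' \<longrightarrow> lp_dist p (\<sigma> n) (\<sigma> n') < e" if "e > 0" for e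
      using \<open>MCauchy \<sigma>\<close> that by (auto simp: MCauchy_def)
    have "Cauchy (\<lambda>n. \<sigma> n j)" for j
    proof (rule metric_CauchyI)
      fix e :: real assume "e > 0"
      then obtain M where "\<forall>n n'. M \<le> n \<longrightarrow> M \<le> n' \<longrightarrow> lp_dist p (\<sigma> n) (\<sigma> n') < e"
        using cau by blast
      moreover have "dist (\<sigma> n j) (\<sigma> n' j) \<le> lp_dist p (\<sigma> n) (\<sigma> n')" for n n'
        using norm_coord_le_lp_norm[OF p lp_diff_mem[OF p mem mem]]
        by (simp add: dist_norm lp_dist_def)
      ultimately show "\<exists>M. \<forall>m\<ge>M. \<forall>n\<ge>M. dist (\<sigma> m j) (\<sigma> n j) < e"
        by (meson order.strict_trans1)
    qed
    then have "\<exists>z. (\<lambda>n. \<sigma> n j) \<longlonglongrightarrow> z" for j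
      by (simp add: Cauchy_convergent_iff convergent_def)
    then obtain z where z: "\<And>j. (\<lambda>n. \<sigma> n j) \<longlonglongrightarrow> z j" by metis
    have z0: "z 0 = 0"
      using z[of 0] mem by (auto simp: lp_space_def LIMSEQ_const_iff)
    \<comment> \<open>Bounds on finite partial sums pass to the coordinatewise limit.\<close>
    have close: "\<exists>M. \<forall>n\<ge>M. (\<lambda>j. \<sigma> n j - z j) \<in> lp_space p \<and> lp_norm p (\<lambda>j. \<sigma> n j - z j) \<le> e"
      if "e > 0" for e
    proof -
      obtain M where M: "\<And>n n'. M \<le> n \<Longrightarrow> M \<le> n' \<Longrightarrow> lp_dist p (\<sigma> n) (\<sigma> n') < e"
        using cau[OF \<open>e > 0\<close>] by blast
      have "(\<Sum>j\<in>F. norm (\<sigma> n j - z j) powr p) \<le> e powr p" if "n \<ge> M" "finite F" for n F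
      proof (rule tendsto_upperbound)
        show "(\<lambda>m. \<Sum>j\<in>F. norm (\<sigma> n j - \<sigma> m j) powr p)
            \<longlonglongrightarrow> (\<Sum>j\<in>F. norm (\<sigma> n j - z j) powr p)"
          using p by (intro tendsto_sum tendsto_powr' tendsto_norm tendsto_diff tendsto_const z) auto
        show "\<forall>\<^sub>F m in sequentially. (\<Sum>j\<in>F. norm (\<sigma> n j - \<sigma> m j) powr p) \<le> e powr p"
          unfolding eventually_sequentially
        proof (intro exI allI impI)
          fix m assume "m \<ge> M"
          have "(\<Sum>j\<in>F. norm (\<sigma> n j - \<sigma> m j) powr p) \<le> lp_dist p (\<sigma> n) (\<sigma> m) powr p"
            unfolding lp_dist_def
            by (rule finite_sum_le_lp_norm[OF p lp_diff_mem[OF p mem mem] \<open>finite F\<close>])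
          also have "\<dots> \<le> e powr p"
            using M[OF \<open>n \<ge> M\<close> \<open>m \<ge> M\<close>] p by (intro powr_mono2) (auto simp: lp_dist_def)
          finally show "(\<Sum>j\<in>F. norm (\<sigma> n j - \<sigma> m j) powr p) \<le> e powr p" .
        qed
      qed simp
      then have "(\<lambda>j. \<sigma> n j - z j) \<in> lp_space p \<and> lp_norm p (\<lambda>j. \<sigma> n j - z j) \<le> e" if "n \<ge> M" for n
        using lp_boundI[OF p, of "\<lambda>j. \<sigma> n j - z j" e] mem[of n] z0 \<open>e > 0\<close> that
        by (auto simp: lp_space_def)
      then show ?thesis by blast
    qed
    have "z \<in> lp_space p"
    proof -
      obtain n where n: "(\<lambda>j. \<sigma> n j - z j) \<in> lp_space p" using close[of 1] by auto
      then show ?thesis using lp_diff_mem[OF p mem[of n] n] by simp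
    qed
    moreover have "\<exists>M. \<forall>n\<ge>M. \<sigma> n \<in> lp_space p \<and> lp_dist p (\<sigma> n) z < e" if "e > 0" for e
    proof -
      obtain M where "\<forall>n\<ge>M. lp_norm p (\<lambda>j. \<sigma> n j - z j) \<le> e/2"
        using close[of "e/2"] \<open>e > 0\<close> by auto
      then show ?thesis
        using mem \<open>e > 0\<close> by (force simp: lp_dist_def)
    qed
    ultimately show "\<exists>x. limitin mtopology \<sigma> x sequentially"
      unfolding limit_metric_sequentially by blast
  qed
qed

section \<open>Positive density and long windows\<close>

text \<open>
  Both families can be described by dense windows \<open>{k+1..k+M}\<close> of unbounded length \<open>M\<close>: for upper
  density the window has to start at \<open>k = 0\<close>, for upper Banach density \<open>k\<close> ranges over \<open>{1..}\<close>.
  With the set \<open>K\<close> of starting points as a parameter, the two cases share their proofs, and the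
  quantity \<open>\<delta>\<close> that Baire category arguments must keep uniform is explicit.
\<close>

definition window_dense :: "nat set \<Rightarrow> real \<Rightarrow> nat set \<Rightarrow> bool" where
  "window_dense K \<delta> A \<longleftrightarrow>
     (\<forall>m. \<exists>M\<ge>m. \<exists>k\<in>K. \<delta> * real M < real (card (A \<inter> {k+1..k+M})))"

lemma limsup_quotient_pos_iff:
  fixes g :: "nat \<Rightarrow> real"
  assumes "g 0 = 0"
  shows "0 < limsup (\<lambda>M. ereal (g M / real M)) \<longleftrightarrow> (\<exists>\<delta>>0. \<forall>m. \<exists>M\<ge>m. \<delta> * real M < g M)"
    (is "0 < ?L \<longleftrightarrow> ?R")
proof
  assume "0 < ?L"
  then obtain \<delta> where \<delta>: "0 < \<delta>" "ereal \<delta> < ?L"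
    using ereal_dense2[of 0 ?L] by auto
  have "\<exists>M\<ge>m. \<delta> * real M < g M" for m
  proof (rule ccontr)
    assume H: "\<not> (\<exists>M\<ge>m. \<delta> * real M < g M)"
    have "\<forall>\<^sub>F M in sequentially. ereal (g M / real M) \<le> ereal \<delta>"
      unfolding eventually_sequentially
    proof (intro exI allI impI)
      fix M assume "Suc m \<le> M"
      then show "ereal (g M / real M) \<le> ereal \<delta>"
        using H by (auto simp: divide_simps not_less)
    qed
    then have "?L \<le> ereal \<delta>" by (rule Limsup_bounded)
    then show False using \<delta> by simp
  qed
  then show ?R using \<delta> by blast
next
  assume ?R
  then obtain \<delta> where \<delta>: "\<delta> > 0" "\<And>m. \<exists>M\<ge>m. \<delta> * real M < g M" by blast
  have "ereal \<delta> \<le> ?L"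
  proof (rule ccontr)
    assume "\<not> ereal \<delta> \<le> ?L"
    then have "\<forall>\<^sub>F M in sequentially. ereal (g M / real M) < ereal \<delta>"
      by (intro Limsup_lessD) simp
    then obtain m where m: "\<And>M. M \<ge> m \<Longrightarrow> g M / real M < \<delta>"
      by (auto simp: eventually_sequentially)
    obtain M where M: "M \<ge> m" "\<delta> * real M < g M" using \<delta>(2) by blast
    have "M \<noteq> 0" using M assms by (intro notI) simp
    then show False using M m[OF M(1)] by (simp add: divide_simps)
  qed
  moreover have "0 < ereal \<delta>" using \<delta> by simp
  ultimately show "0 < ?L" by (rule order_less_le_trans[rotated])
qed

lemma family_ud_iff_window_dense:
  "A \<in> family_ud \<longleftrightarrow> A \<subseteq> {1..} \<and> (\<exists>\<delta>>0. window_dense {0} \<delta> A)"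
  using limsup_quotient_pos_iff[of "\<lambda>M. real (card (A \<inter> {1..M}))"]
  by (simp add: family_ud_def upper_density_def window_dense_def)

lemma family_uBd_iff_window_dense:
  "A \<in> family_uBd \<longleftrightarrow> A \<subseteq> {1..} \<and> (\<exists>\<delta>>0. window_dense {1..} \<delta> A)"
proof -
  let ?g = "\<lambda>M. real (MAX k\<in>{1..}. card (A \<inter> {k+1..k+M}))"
  have ne: "(\<lambda>k. card (A \<inter> {k+1..k+M})) ` {1::nat..} \<noteq> {}" for M by auto
  have "\<delta> * real M < ?g M \<longleftrightarrow> (\<exists>k\<in>{1..}. \<delta> * real M < real (card (A \<inter> {k+1..k+M})))" for \<delta> M
  proof
    assume "\<delta> * real M < ?g M"
    moreover obtain k where "k \<in> {1..}" "(MAX k\<in>{1..}. card (A \<inter> {k+1..k+M})) = card (A \<inter> {k+1..k+M})"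
      using Max_in[OF finite_window_cards ne] by (metis (no_types, lifting) imageE)
    ultimately show "\<exists>k\<in>{1..}. \<delta> * real M < real (card (A \<inter> {k+1..k+M}))" by metis
  next
    assume "\<exists>k\<in>{1..}. \<delta> * real M < real (card (A \<inter> {k+1..k+M}))"
    then obtain k where k: "k \<in> {1..}" "\<delta> * real M < real (card (A \<inter> {k+1..k+M}))" by blast
    have "card (A \<inter> {k+1..k+M}) \<le> (MAX k\<in>{1..}. card (A \<inter> {k+1..k+M}))"
      using k by (intro Max_ge finite_window_cards imageI)
    then show "\<delta> * real M < ?g M" using k(2) by linarith
  qed
  moreover have "?g 0 = 0"
  proof -
    have "(\<lambda>k::nat. card (A \<inter> {k+1..k+0})) ` {1..} = {0}" by force
    then show ?thesis by simp
  qed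
  ultimately show ?thesis
    using limsup_quotient_pos_iff[of ?g]
    unfolding family_uBd_def upper_Banach_density_def window_dense_def by simp
qed

lemma window_dense_mono:
  assumes "window_dense K \<delta> A" "A \<subseteq> B" "\<delta>' \<le> \<delta>"
  shows "window_dense K \<delta>' B"
  unfolding window_dense_def
proof
  fix m
  obtain M k where M: "M \<ge> m" "k \<in> K" "\<delta> * real M < real (card (A \<inter> {k+1..k+M}))"
    using assms(1) unfolding window_dense_def by meson
  have "card (A \<inter> {k+1..k+M}) \<le> card (B \<inter> {k+1..k+M})"
    using assms(2) by (intro card_mono) auto
  moreover have "\<delta>' * real M \<le> \<delta> * real M" using assms(3) by (simp add: mult_right_mono)
  ultimately have "\<delta>' * real M < real (card (B \<inter> {k+1..k+M}))" using M(3) by linarith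
  then show "\<exists>M\<ge>m. \<exists>k\<in>K. \<delta>' * real M < real (card (B \<inter> {k+1..k+M}))" using M by blast
qed

lemma window_dense_remove_initial:
  assumes "window_dense K \<delta> A" "\<delta> > 0"
  shows "window_dense K (\<delta>/2) (A \<inter> {m0..})"
  unfolding window_dense_def
proof
  fix m
  obtain M k where M: "M \<ge> max m (nat \<lceil>2 * real m0 / \<delta>\<rceil>)" "k \<in> K"
      "\<delta> * real M < real (card (A \<inter> {k+1..k+M}))"
    using assms(1) unfolding window_dense_def by meson
  have "card (A \<inter> {k+1..k+M}) \<le> card (A \<inter> {m0..} \<inter> {k+1..k+M} \<union> {..<m0})"
    by (intro card_mono) auto
  also have "\<dots> \<le> card (A \<inter> {m0..} \<inter> {k+1..k+M}) + m0"
    using card_Un_le[of "A \<inter> {m0..} \<inter> {k+1..k+M}" "{..<m0}"] by simp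
  finally have "real (card (A \<inter> {k+1..k+M})) \<le> real (card (A \<inter> {m0..} \<inter> {k+1..k+M})) + real m0"
    by linarith
  moreover have "real m0 \<le> \<delta> / 2 * real M"
  proof -
    have "2 * real m0 / \<delta> \<le> real M" using M(1) by linarith
    then show ?thesis using assms(2) by (simp add: field_simps)
  qed
  ultimately have "\<delta> / 2 * real M < real (card (A \<inter> {m0..} \<inter> {k+1..k+M}))"
    using M(3) by (simp add: field_simps)
  then show "\<exists>M\<ge>m. \<exists>k\<in>K. \<delta> / 2 * real M < real (card (A \<inter> {m0..} \<inter> {k+1..k+M}))"
    using M by auto
qed

lemma window_dense_infinite:
  assumes "window_dense K \<delta> A" "\<delta> > 0"
  shows "\<exists>n\<in>A. m \<le> n"
proof -
  obtain M k where "\<delta> / 2 * real M < real (card (A \<inter> {m..} \<inter> {k+1..k+M}))"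
    using window_dense_remove_initial[OF assms, of m] unfolding window_dense_def by meson
  moreover have "0 \<le> \<delta> / 2 * real M" using assms(2) by simp
  ultimately have "A \<inter> {m..} \<inter> {k+1..k+M} \<noteq> {}" by auto
  then show ?thesis by auto
qed

lemma window_dense_ud_imp_uBd:
  assumes "window_dense {0} \<delta> A" "\<delta> > 0"
  shows "window_dense {1..} (\<delta>/2) A"
  unfolding window_dense_def
proof
  fix m
  obtain M where M: "M \<ge> m" "\<delta> / 2 * real M < real (card (A \<inter> {2..} \<inter> {1..M}))"
    using window_dense_remove_initial[OF assms, of 2] unfolding window_dense_def by force
  have "card (A \<inter> {2..} \<inter> {1..M}) \<le> card (A \<inter> {1+1..1+M})" by (intro card_mono) auto
  then show "\<exists>M\<ge>m. \<exists>k\<in>{1..}. \<delta> / 2 * real M < real (card (A \<inter> {k+1..k+M}))"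
    using M by (intro exI[of _ M] conjI bexI[of _ 1]) (linarith | simp)+
qed

text \<open>
  Slightly below the upper Banach density \<open>d\<close> there are arbitrarily long windows of density at least
  \<open>7d/8\<close>, while slightly above it no window of a large enough length \<open>G\<close> has density more than
  \<open>9d/8\<close>. Inside a long window, the subwindows of length \<open>G\<close> therefore cannot carry all of its mass
  unless a proportion of about \<open>7/9 > 2/3\<close> of them meet the set.
\<close>

lemma Banach_dense_thickening:
  assumes "window_dense {1..} \<delta> A" "\<delta> > 0"
  shows "\<exists>G\<ge>1. window_dense {1..} (2/3) {n. \<exists>i\<in>{1..G}. n + i \<in> A}"
proof -
  \<comment> \<open>\<open>Sup S\<close> is the upper Banach density of \<open>A\<close>\<close>
  define S where "S = {\<delta>. window_dense {1..} \<delta> A}"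
  have le1: "x \<le> 1" if x: "x \<in> S" for x
  proof -
    obtain M k where "x * real M < real (card (A \<inter> {k+1..k+M}))"
      using x unfolding S_def window_dense_def mem_Collect_eq by meson
    moreover have "card (A \<inter> {k+1..k+M}) \<le> card {k+1..k+M}" by (intro card_mono) auto
    ultimately have "x * real M < 1 * real M" by simp
    then show ?thesis using mult_right_mono[of 1 x "real M"] by linarith
  qed
  define d where "d = Sup S"
  have bdd: "bdd_above S" using le1 by (auto simp: bdd_above_def)
  have "\<delta> \<le> d" unfolding d_def using assms by (intro cSup_upper bdd) (simp add: S_def)
  then have d: "d > 0" using assms by simp
  obtain \<delta>1 where \<delta>1: "\<delta>1 \<in> S" "7/8 * d < \<delta>1"
    using less_cSup_iff[of S "7/8 * d"] assms bdd d by (auto simp: d_def S_def)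
  have "9/8 * d \<notin> S"
  proof
    assume "9/8 * d \<in> S"
    then have "9/8 * d \<le> d" unfolding d_def by (intro cSup_upper bdd)
    then show False using d by simp
  qed
  then obtain m where m: "\<And>M k. M \<ge> m \<Longrightarrow> k \<ge> 1 \<Longrightarrow> real (card (A \<inter> {k+1..k+M})) \<le> 9/8 * d * real M"
    unfolding S_def window_dense_def by (auto simp: not_less)
  define G where "G = max m 1"
  define A' where "A' = {n. \<exists>i\<in>{1..G}. n + i \<in> A}"
  have G: "G \<ge> 1" "G \<ge> m" by (auto simp: G_def)
  have "window_dense {1..} (2/3) A'"
    unfolding window_dense_def
  proof
    fix m'
    have "\<exists>M\<ge>max m' (Suc (nat \<lceil>8 * real G / d\<rceil>)). \<exists>k\<in>{1..}. \<delta>1 * real M < real (card (A \<inter> {k+1..k+M}))"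
      using \<delta>1(1) unfolding S_def window_dense_def by blast
    then obtain M k where M: "M \<ge> m'" "M \<ge> Suc (nat \<lceil>8 * real G / d\<rceil>)" "k \<ge> 1"
        "\<delta>1 * real M < real (card (A \<inter> {k+1..k+M}))"
      by auto
    define I where "I = {k+1..k+M}"
    define a where "a = real (card (A \<inter> I))"
    have MG: "8 * real G < d * real M"
    proof -
      have "8 * real G / d < real M" using M(2) by linarith
      then show ?thesis using d by (simp add: field_simps)
    qed
    have a: "7/8 * d * real M \<le> a"
      using M(4) \<delta>1(2) mult_right_mono[of "7/8 * d" \<delta>1 "real M"] by (simp add: a_def I_def)
    have shift: "a - real G \<le> (\<Sum>n\<in>I. of_bool (n + i \<in> A))" if i: "i \<in> {1..G}" for i
    proof -
      have "card (A \<inter> I) \<le> card ((\<lambda>n. n + i) ` {n\<in>I. n + i \<in> A} \<union> {k+1..k+i})"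
      proof (intro card_mono subsetI)
        fix b assume b: "b \<in> A \<inter> I"
        show "b \<in> (\<lambda>n. n + i) ` {n\<in>I. n + i \<in> A} \<union> {k+1..k+i}"
        proof (cases "b \<le> k + i")
          case False
          then have "b = (b - i) + i \<and> b - i \<in> {n\<in>I. n + i \<in> A}" using b i by (auto simp: I_def)
          then show ?thesis by blast
        qed (use b in \<open>auto simp: I_def\<close>)
      qed (auto simp: I_def)
      also have "\<dots> \<le> card ((\<lambda>n. n + i) ` {n\<in>I. n + i \<in> A}) + card {k+1..k+i}"
        by (rule card_Un_le)
      also have "\<dots> \<le> card {n\<in>I. n + i \<in> A} + G"
        using i by (intro add_mono card_image_le) (auto simp: I_def)
      finally have "a \<le> real (card {n\<in>I. n + i \<in> A}) + real G" unfolding a_def by linarith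
      moreover have "(\<Sum>n\<in>I. of_bool (n + i \<in> A) :: real) = real (card {n\<in>I. n + i \<in> A})"
        by (simp add: I_def of_bool_def sum.If_cases Int_def)
      ultimately show ?thesis by linarith
    qed
    have sub: "(\<Sum>i\<in>{1..G}. of_bool (n + i \<in> A)) \<le> 9/8 * d * real G * of_bool (n \<in> A')"
      if n: "n \<in> I" for n
    proof (cases "n \<in> A'")
      case True
      have "(\<Sum>i\<in>{1..G}. of_bool (n + i \<in> A) :: real) = real (card {i\<in>{1..G}. n + i \<in> A})"
        by (simp add: of_bool_def sum.If_cases Int_def)
      also have "card {i\<in>{1..G}. n + i \<in> A} = card ((\<lambda>i. n + i) ` {i\<in>{1..G}. n + i \<in> A})"
        by (subst card_image) (auto simp: inj_on_def)
      also have "(\<lambda>i. n + i) ` {i\<in>{1..G}. n + i \<in> A} = A \<inter> {n+1..n+G}"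
      proof (intro equalityI subsetI)
        fix b assume "b \<in> A \<inter> {n+1..n+G}"
        then have "b = n + (b - n) \<and> b - n \<in> {i\<in>{1..G}. n + i \<in> A}" by auto
        then show "b \<in> (\<lambda>i. n + i) ` {i\<in>{1..G}. n + i \<in> A}" by blast
      qed auto
      also have "real (card (A \<inter> {n+1..n+G})) \<le> 9/8 * d * real G"
        using n M(3) G(2) by (intro m) (auto simp: I_def)
      finally show ?thesis using True by simp
    next
      case False
      then show ?thesis by (auto simp: A'_def)
    qed
    have "real G * (a - real G) \<le> (\<Sum>i\<in>{1..G}. \<Sum>n\<in>I. of_bool (n + i \<in> A))"
      using sum_bounded_below[of "{1..G}" "a - real G", OF shift] by simp
    also have "\<dots> = (\<Sum>n\<in>I. \<Sum>i\<in>{1..G}. of_bool (n + i \<in> A))" by (rule sum.swap)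
    also have "\<dots> \<le> (\<Sum>n\<in>I. 9/8 * d * real G * of_bool (n \<in> A'))" by (intro sum_mono sub)
    also have "\<dots> = real G * (9/8 * d * real (card (A' \<inter> I)))"
      unfolding sum_distrib_left[symmetric]
      by (simp add: I_def of_bool_def sum.If_cases Int_commute)
    finally have "a - real G \<le> 9/8 * d * real (card (A' \<inter> I))" using G(1) by simp
    then have "d * (3/4 * real M) < d * (9/8 * real (card (A' \<inter> I)))"
      using a MG by (simp add: algebra_simps)
    then have "2/3 * real M < real (card (A' \<inter> I))" using d by simp
    then show "\<exists>M\<ge>m'. \<exists>k\<in>{1..}. 2/3 * real M < real (card (A' \<inter> {k+1..k+M}))"
      using M unfolding I_def by auto
  qed
  then show ?thesis using G(1) unfolding A'_def by blast
qed

text \<open>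
  The thickening \<open>A'\<close> of \<open>A\<close> fills more than half of some long windows, so every shift \<open>h\<close> is
  realised as a difference of two elements of \<open>A'\<close> for at least a sixth of the points of such a
  window, provided that it is long compared with \<open>h\<close>. Averaging the hypothesis over these points bounds \<open>c 1 + \<dots> + c K\<close>; passing from \<open>A'\<close> back
  to \<open>A\<close> moves indices by at most \<open>2G\<close>, which the growth condition on \<open>c\<close> absorbs in a constant.
  The bound is independent of \<open>K\<close>, so that the sparse information on \<open>A - A\<close> controls the whole
  series.
\<close>

lemma bounded_sums_of_Banach_dense_differences:
  fixes c :: "nat \<Rightarrow> real"
  assumes dense: "window_dense {1..} \<delta> A" "\<delta> > 0"
    and c0: "\<And>k. 0 \<le> c k" and E: "1 \<le> E" and growth: "\<And>k. c k \<le> E * c (Suc k)"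
    and diff: "\<And>n F. n \<in> A \<Longrightarrow> finite F \<Longrightarrow> F \<subseteq> A \<inter> {n<..} \<Longrightarrow> (\<Sum>m\<in>F. c (m - n)) \<le> C"
  shows "\<exists>B. \<forall>K. (\<Sum>k\<in>{1..K}. c k) \<le> B"
proof -
  obtain G where G: "G \<ge> 1" and A'd: "window_dense {1..} (2/3) {n. \<exists>i\<in>{1..G}. n + i \<in> A}"
    using Banach_dense_thickening[OF dense] by blast
  define A' where "A' = {n. \<exists>i\<in>{1..G}. n + i \<in> A}"
  have grow: "c k \<le> E ^ e * c (k + e)" for k e
  proof (induction e)
    case (Suc e)
    have "E ^ e * c (k + e) \<le> E ^ e * (E * c (Suc (k + e)))"
      using growth E by (intro mult_left_mono) auto
    then show ?case using Suc by (simp add: mult_ac)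
  qed simp
  have C0: "0 \<le> C" using diff[of _ "{}"] window_dense_infinite[OF dense] by auto
  have point: "(\<Sum>k\<in>{k\<in>{1..K}. n + k + G \<in> A'}. c k) \<le> real G * E ^ (2*G) * C"
    if "n \<in> A'" for n K
  proof -
    obtain i where i: "i \<in> {1..G}" "n + i \<in> A" using \<open>n \<in> A'\<close> by (auto simp: A'_def)
    \<comment> \<open>Each \<open>k\<close> in the sum is moved to a difference \<open>m - (n + i)\<close> of elements of \<open>A\<close> with
      \<open>k < m - (n + i) \<le> k + 2G\<close>; the shift \<open>k + G\<close> instead of \<open>k\<close> keeps this difference above \<open>k\<close>, where
      the growth condition is usable.\<close>
    define F where "F = {m\<in>A. n + i < m \<and> m \<le> n + K + 2*G}"
    have fF: "finite F" by (rule finite_subset[of _ "{..n + K + 2*G}"]) (auto simp: F_def)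
    have "(\<Sum>k\<in>{k\<in>{1..K}. n + k + G \<in> A'}. c k)
        \<le> (\<Sum>(m, i')\<in>F \<times> {1..G}. E ^ (2*G) * c (m - (n + i)))"
    proof (rule sum_le_included[where i = "\<lambda>(m, i'). m - (n + G + i')"])
      show "\<forall>k\<in>{k\<in>{1..K}. n + k + G \<in> A'}. \<exists>y\<in>F \<times> {1..G}.
          (case y of (m, i') \<Rightarrow> m - (n + G + i')) = k \<and>
          c k \<le> (case y of (m, i') \<Rightarrow> E ^ (2*G) * c (m - (n + i)))"
      proof
        fix k assume k: "k \<in> {k\<in>{1..K}. n + k + G \<in> A'}"
        then obtain i' where i': "i' \<in> {1..G}" "n + k + G + i' \<in> A" by (auto simp: A'_def)
        have "c k \<le> E ^ (G + i' - i) * c (k + (G + i' - i))" by (rule grow)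
        also have "\<dots> \<le> E ^ (2*G) * c (k + (G + i' - i))"
          using E c0 i' by (intro mult_right_mono power_increasing) auto
        also have "k + (G + i' - i) = n + k + G + i' - (n + i)" using i by auto
        finally show "\<exists>y\<in>F \<times> {1..G}.
          (case y of (m, i') \<Rightarrow> m - (n + G + i')) = k \<and>
          c k \<le> (case y of (m, i') \<Rightarrow> E ^ (2*G) * c (m - (n + i)))"
          using i i' k by (intro bexI[of _ "(n + k + G + i', i')"]) (auto simp: F_def)
      qed
    qed (use fF c0 E in auto)
    also have "\<dots> = real G * E ^ (2*G) * (\<Sum>m\<in>F. c (m - (n + i)))"
      by (simp add: sum.cartesian_product[symmetric] sum_distrib_left mult_ac)
    also have "\<dots> \<le> real G * E ^ (2*G) * C"
      using i fF E by (intro mult_left_mono diff) (auto simp: F_def)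
    finally show ?thesis .
  qed
  have "(\<Sum>k\<in>{1..K}. c k) \<le> 6 * (real G * E ^ (2*G) * C)" for K
  proof -
    have "\<exists>M\<ge>Suc (6 * (K + G)). \<exists>k\<in>{1..}. 2/3 * real M < real (card (A' \<inter> {k+1..k+M}))"
      using A'd unfolding window_dense_def A'_def by blast
    then obtain M k0 where M: "M \<ge> Suc (6 * (K + G))"
      "2/3 * real M < real (card (A' \<inter> {k0+1..k0+M}))" by blast
    define I where "I = {k0+1..k0+M}"
    have many: "real M / 6 \<le> real (card {n\<in>A' \<inter> I. n + k + G \<in> A'})" if k: "k \<in> {1..K}" for k
    proof -
      define h where "h = k + G"
      have "card (A' \<inter> I) \<le> card ((\<lambda>n. n + h) ` {n\<in>I. n + h \<in> A'} \<union> {k0+1..k0+h})"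
      proof (intro card_mono subsetI)
        fix b assume b: "b \<in> A' \<inter> I"
        show "b \<in> (\<lambda>n. n + h) ` {n\<in>I. n + h \<in> A'} \<union> {k0+1..k0+h}"
        proof (cases "b \<le> k0 + h")
          case False
          then have "b = (b - h) + h \<and> b - h \<in> {n\<in>I. n + h \<in> A'}" using b by (auto simp: I_def)
          then show ?thesis by blast
        qed (use b in \<open>auto simp: I_def\<close>)
      qed (auto simp: I_def)
      also have "\<dots> \<le> card ((\<lambda>n. n + h) ` {n\<in>I. n + h \<in> A'}) + card {k0+1..k0+h}"
        by (rule card_Un_le)
      also have "\<dots> \<le> card {n\<in>I. n + h \<in> A'} + h"
        by (intro add_mono card_image_le) (auto simp: I_def)
      finally have 1: "real (card (A' \<inter> I)) \<le> real (card {n\<in>I. n + h \<in> A'}) + real h" by linarith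
      have "card (A' \<inter> I) + card {n\<in>I. n + h \<in> A'}
          = card (A' \<inter> I \<union> {n\<in>I. n + h \<in> A'}) + card (A' \<inter> I \<inter> {n\<in>I. n + h \<in> A'})"
        by (rule card_Un_Int) (auto simp: I_def)
      moreover have "card (A' \<inter> I \<union> {n\<in>I. n + h \<in> A'}) \<le> card I"
        by (intro card_mono) (auto simp: I_def)
      moreover have "A' \<inter> I \<inter> {n\<in>I. n + h \<in> A'} = {n\<in>A' \<inter> I. n + k + G \<in> A'}"
        by (auto simp: h_def add.assoc)
      ultimately have "real (card (A' \<inter> I)) + real (card {n\<in>I. n + h \<in> A'})
          \<le> real M + real (card {n\<in>A' \<inter> I. n + k + G \<in> A'})"
        by (simp add: I_def)
      moreover have "6 * real h \<le> real M" using k M(1) by (simp add: h_def)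
      ultimately show ?thesis using M(2) 1 unfolding I_def[symmetric] by linarith
    qed
    have "real M / 6 * (\<Sum>k\<in>{1..K}. c k) \<le> (\<Sum>k\<in>{1..K}. real (card {n\<in>A' \<inter> I. n + k + G \<in> A'}) * c k)"
      unfolding sum_distrib_left using c0 many by (intro sum_mono mult_right_mono) auto
    also have "\<dots> = (\<Sum>k\<in>{1..K}. \<Sum>n\<in>A' \<inter> I. if n + k + G \<in> A' then c k else 0)"
      by (intro sum.cong refl) (simp add: sum.If_cases I_def Int_def)
    also have "\<dots> = (\<Sum>n\<in>A' \<inter> I. \<Sum>k\<in>{1..K}. if n + k + G \<in> A' then c k else 0)"
      by (rule sum.swap)
    also have "\<dots> = (\<Sum>n\<in>A' \<inter> I. \<Sum>k\<in>{k\<in>{1..K}. n + k + G \<in> A'}. c k)"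
      by (rule sum.cong[OF refl], rule sum.inter_filter[symmetric]) simp
    also have "\<dots> \<le> (\<Sum>n\<in>A' \<inter> I. real G * E ^ (2*G) * C)"
      using point by (intro sum_mono) auto
    also have "\<dots> \<le> real M * (real G * E ^ (2*G) * C)"
    proof -
      have "card (A' \<inter> I) \<le> card I" by (intro card_mono) (auto simp: I_def)
      then have "real (card (A' \<inter> I)) \<le> real M" by (simp add: I_def)
      then have "real (card (A' \<inter> I)) * (real G * E ^ (2*G) * C) \<le> real M * (real G * E ^ (2*G) * C)"
        using C0 E by (intro mult_right_mono) auto
      then show ?thesis by simp
    qed
    finally have "real M * (\<Sum>k\<in>{1..K}. c k) \<le> real M * (6 * (real G * E ^ (2*G) * C))" by simp
    then show ?thesis using M(1) by (subst (asm) mult_le_cancel_left_pos) auto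
  qed
  then show ?thesis by blast
qed

section \<open>Iterates of pseudo-shifts\<close>

lemma pseudo_shift_data_funpow_ge:
  assumes fw: "pseudo_shift_data f w" and "1 \<le> j"
  shows "j + n \<le> (f ^^ n) j"
proof -
  have step: "Suc i \<le> f i" if "1 \<le> i" for i
    using that
  proof (induction i rule: dec_induct)
    case base
    then show ?case using fw by (simp add: pseudo_shift_data_def)
  next
    case (step i)
    have "f i < f (Suc i)"
      using fw step by (auto simp: pseudo_shift_data_def intro: strict_mono_onD)
    then show ?case using step by linarith
  qed
  show ?thesis
  proof (induction n)
    case (Suc n)
    then show ?case using step[of "(f ^^ n) j"] assms(2) by simp
  qed simp
qed

lemma pseudo_shift_data_funpow_less:
  assumes fw: "pseudo_shift_data f w" and "1 \<le> i" "i < j"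
  shows "(f ^^ n) i < (f ^^ n) j"
proof (induction n)
  case (Suc n)
  have "1 \<le> (f ^^ n) i" using pseudo_shift_data_funpow_ge[OF fw \<open>1 \<le> i\<close>, of n] assms(2) by linarith
  then show ?case
    using Suc fw by (auto simp: pseudo_shift_data_def intro: strict_mono_onD)
qed (use assms in simp)

lemma pseudo_shift_data_funpow_inj:
  assumes fw: "pseudo_shift_data f w" and "1 \<le> i" "1 \<le> j" "(f ^^ n) i = (f ^^ n) j"
  shows "i = j"
  using pseudo_shift_data_funpow_less[OF fw \<open>1 \<le> i\<close>, of j n]
    pseudo_shift_data_funpow_less[OF fw \<open>1 \<le> j\<close>, of i n] assms(4)
  by (cases i j rule: linorder_cases) auto

lemma iter_inv_funpow:
  assumes fw: "pseudo_shift_data f w" and "1 \<le> k"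
  shows "iter_inv f n ((f ^^ n) k) = k"
  unfolding iter_inv_def
  by (rule inv_into_f_f)
     (use assms in \<open>auto simp: inj_on_def dest: pseudo_shift_data_funpow_inj[OF fw, rotated 2]\<close>)

lemma funpow_diff:
  assumes "n \<le> m"
  shows "(f ^^ n) ((f ^^ (m - n)) j) = (f ^^ m) j"
proof -
  have "f ^^ m = f ^^ n \<circ> f ^^ (m - n)" using assms by (simp flip: funpow_add)
  then show ?thesis by simp
qed

lemma funpow_eq_funpow_cases:
  assumes fw: "pseudo_shift_data f w" and "1 \<le> j" "j < k" and eq: "(f ^^ m) j = (f ^^ n) k"
  shows "n < m" "k = (f ^^ (m - n)) j"
proof -
  have "\<not> m \<le> n"
  proof
    assume "m \<le> n"
    then have "(f ^^ m) ((f ^^ (n - m)) k) = (f ^^ m) j" using eq by (simp add: funpow_diff)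
    moreover have k: "k + (n - m) \<le> (f ^^ (n - m)) k"
      using pseudo_shift_data_funpow_ge[OF fw] assms by simp
    ultimately have "(f ^^ (n - m)) k = j"
      using assms by (intro pseudo_shift_data_funpow_inj[OF fw, of _ j m]) auto
    then show False using k assms by simp
  qed
  then show "n < m" by simp
  have "(f ^^ n) ((f ^^ (m - n)) j) = (f ^^ n) k" using eq \<open>n < m\<close> by (simp add: funpow_diff)
  moreover have "1 \<le> (f ^^ (m - n)) j"
    using pseudo_shift_data_funpow_ge[OF fw \<open>1 \<le> j\<close>, of "m - n"] assms by simp
  ultimately show "k = (f ^^ (m - n)) j"
    using assms pseudo_shift_data_funpow_inj[OF fw, of "(f ^^ (m - n)) j" k n] by simp
qed

lemma inj_on_funpow_exponent:
  assumes fw: "pseudo_shift_data f w" and "1 \<le> j"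
  shows "inj (\<lambda>m. (f ^^ m) j)"
proof -
  have "(f ^^ n) j < (f ^^ m) j" if "n < m" for m n
  proof -
    have "j + (m - n) \<le> (f ^^ (m - n)) j" by (rule pseudo_shift_data_funpow_ge[OF fw \<open>1 \<le> j\<close>])
    then have "j < (f ^^ (m - n)) j" using that by simp
    then have "(f ^^ n) j < (f ^^ n) ((f ^^ (m - n)) j)"
      by (rule pseudo_shift_data_funpow_less[OF fw \<open>1 \<le> j\<close>])
    then show ?thesis using that by (simp add: funpow_diff)
  qed
  then show ?thesis by (intro linorder_injI) (auto simp: neq_iff)
qed

lemma weight_prod_0 [simp]: "weight_prod f w j 0 = 1"
  by (simp add: weight_prod_def)

lemma weight_prod_Suc: "weight_prod f w j (Suc n) = weight_prod f w j n * w ((f ^^ Suc n) j)"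
  by (simp add: weight_prod_def)

lemma weight_prod_add:
  "weight_prod f w j (m + n) = weight_prod f w j m * weight_prod f w ((f ^^ m) j) n"
proof (induction n)
  case (Suc n)
  have "(f ^^ Suc n) ((f ^^ m) j) = (f ^^ Suc (m + n)) j"
    by (metis add.commute add_Suc comp_apply funpow_add)
  then show ?case using Suc by (simp only: weight_prod_Suc add_Suc_right mult.assoc)
qed simp

lemma weight_prod_diff:
  assumes "n \<le> m"
  shows "weight_prod f w j m = weight_prod f w j (m - n) * weight_prod f w ((f ^^ (m - n)) j) n"
  using weight_prod_add[of f w j "m - n" n] assms by simp

lemma weight_prod_nonzero_mono:
  assumes "weight_prod f w j m \<noteq> 0" "n \<le> m"
  shows "weight_prod f w j n \<noteq> 0"
  using weight_prod_add[of f w j n "m - n"] assms by auto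

lemma pseudo_shift_funpow_apply:
  assumes fw: "pseudo_shift_data f w" and "x 0 = 0"
  shows "(pseudo_shift f w ^^ n) x j = (if 1 \<le> j then weight_prod f w j n * x ((f ^^ n) j) else 0)"
  using assms(2)
proof (induction n arbitrary: x)
  case (Suc n)
  have "(pseudo_shift f w ^^ Suc n) x j = (pseudo_shift f w ^^ n) (pseudo_shift f w x) j"
    by (simp add: funpow_swap1)
  also have "\<dots> = (if 1 \<le> j then weight_prod f w j n * pseudo_shift f w x ((f ^^ n) j) else 0)"
    by (rule Suc.IH) (simp add: pseudo_shift_def)
  also have "\<dots> = (if 1 \<le> j then weight_prod f w j (Suc n) * x ((f ^^ Suc n) j) else 0)"
    using pseudo_shift_data_funpow_ge[OF fw, of j n]
    by (cases "1 \<le> j") (force simp: pseudo_shift_def weight_prod_Suc mult.assoc)+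
  finally show ?case .
qed (auto simp: Suc_le_eq)

lemma pseudo_shift_funpow_mem_lp:
  assumes "pseudo_shift_data f w" "1 \<le> p" "x \<in> lp_space p"
  shows "(pseudo_shift f w ^^ n) x \<in> lp_space p"
  using assms by (induction n) (auto intro: pseudo_shift_mem_lp)

lemma pseudo_shift_weights_bounded:
  assumes "pseudo_shift_data f w"
  shows "\<exists>E\<ge>1. \<forall>j\<ge>1. norm (w j) \<le> E"
proof -
  obtain C where C: "\<And>j. j \<ge> 1 \<Longrightarrow> norm (w j) \<le> C"
    using assms by (auto simp: pseudo_shift_data_def bounded_iff)
  then show ?thesis by (intro exI[of _ "max 1 C"]) (auto simp: le_max_iff_disj)
qed

lemma pseudo_shift_funpow_Lipschitz:
  assumes fw: "pseudo_shift_data f w" and p: "1 \<le> p"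
  shows "\<exists>B>0. \<forall>x\<in>lp_space p. \<forall>y\<in>lp_space p.
    lp_dist p ((pseudo_shift f w ^^ n) x) ((pseudo_shift f w ^^ n) y) \<le> B * lp_dist p x y"
proof -
  obtain E where E: "E \<ge> 1" "\<And>j. j \<ge> 1 \<Longrightarrow> norm (w j) \<le> E"
    using pseudo_shift_weights_bounded[OF fw] by blast
  have f1: "1 \<le> f j" if "1 \<le> j" for j
    using pseudo_shift_data_funpow_ge[OF fw that, of 1] that by simp
  have one: "lp_dist p (pseudo_shift f w x) (pseudo_shift f w y) \<le> E * lp_dist p x y"
    if x: "x \<in> lp_space p" and y: "y \<in> lp_space p" for x y
    unfolding lp_dist_def
  proof (rule lp_boundI[OF p])
    let ?d = "\<lambda>j. x j - y j"
    let ?D = "\<lambda>j. pseudo_shift f w x j - pseudo_shift f w y j"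
    fix F :: "nat set" assume F: "finite F"
    have "(\<Sum>j\<in>F. norm (?D j) powr p) = (\<Sum>j\<in>F \<inter> {1..}. norm (?D j) powr p)"
      using F by (intro sum.mono_neutral_right) (auto simp: pseudo_shift_def)
    also have "\<dots> \<le> (\<Sum>j\<in>F \<inter> {1..}. E powr p * norm (?d (f j)) powr p)"
    proof (rule sum_mono)
      fix j assume j: "j \<in> F \<inter> {1..}"
      then have "norm (?D j) = norm (w (f j)) * norm (?d (f j))"
        by (simp add: pseudo_shift_def norm_mult flip: right_diff_distrib)
      also have "\<dots> \<le> E * norm (?d (f j))"
        using E f1 j by (intro mult_right_mono) auto
      finally have "norm (?D j) powr p \<le> (E * norm (?d (f j))) powr p"
        using p by (intro powr_mono2) auto
      then show "norm (?D j) powr p \<le> E powr p * norm (?d (f j)) powr p"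
        using E by (simp add: powr_mult)
    qed
    also have "\<dots> = E powr p * (\<Sum>i\<in>f ` (F \<inter> {1..}). norm (?d i) powr p)"
      using pseudo_shift_data_funpow_inj[OF fw, of _ _ 1]
      by (subst sum.reindex) (auto simp: inj_on_def sum_distrib_left)
    also have "\<dots> \<le> E powr p * lp_norm p ?d powr p"
      using F by (intro mult_left_mono finite_sum_le_lp_norm p lp_diff_mem x y) auto
    also have "\<dots> = (E * lp_norm p ?d) powr p" using E by (simp add: powr_mult)
    finally show "(\<Sum>j\<in>F. norm (?D j) powr p) \<le> (E * lp_norm p ?d) powr p" .
  qed (use E in \<open>auto simp: pseudo_shift_def\<close>)
  have "lp_dist p ((pseudo_shift f w ^^ n) x) ((pseudo_shift f w ^^ n) y) \<le> E ^ n * lp_dist p x y"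
    if x: "x \<in> lp_space p" and y: "y \<in> lp_space p" for x y
  proof (induction n)
    case (Suc n)
    have "lp_dist p ((pseudo_shift f w ^^ Suc n) x) ((pseudo_shift f w ^^ Suc n) y)
        \<le> E * lp_dist p ((pseudo_shift f w ^^ n) x) ((pseudo_shift f w ^^ n) y)"
      using one[OF pseudo_shift_funpow_mem_lp[OF fw p x, of n] pseudo_shift_funpow_mem_lp[OF fw p y, of n]]
      by simp
    also have "\<dots> \<le> E * (E ^ n * lp_dist p x y)" using Suc E by (intro mult_left_mono) auto
    finally show ?case by (simp add: mult_ac)
  qed simp
  then show ?thesis using E by (intro exI[of _ "E ^ n"]) auto
qed

section \<open>Necessity\<close>

text \<open>
  A coordinate of \<open>T\<^sup>n x\<close> at \<open>f\<^sup>m\<^sup>-\<^sup>n j\<close> is \<open>W\<^sub>j\<^sub>,\<^sub>m x (f\<^sup>m j)\<close> divided by \<open>W\<^sub>j\<^sub>,\<^sub>m\<^sub>-\<^sub>n\<close>. If \<open>n\<close> and \<open>m\<close> are both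
  return times to a ball whose elements have a \<open>j\<close>-th coordinate away from zero, then the numerator is
  bounded below, so that the norm of \<open>T\<^sup>n x\<close> controls the sum of \<open>1 / \<bar>W\<^sub>j\<^sub>,\<^sub>m\<^sub>-\<^sub>n\<bar>\<^sup>p\<close> over the return
  times \<open>m > n\<close>. The passage from differences of return times to all integers is
  \<open>bounded_sums_of_Banach_dense_differences\<close>, whose growth condition is the boundedness of the weights.
\<close>

lemma weight_inverse_sums_bounded_of_returns:
  fixes w :: "nat \<Rightarrow> 'k::real_normed_field"
  assumes fw: "pseudo_shift_data f w" and p: "1 \<le> p" and x: "x \<in> lp_space p" and y: "y \<in> lp_space p"
    and dense: "window_dense {1..} \<delta> A" "\<delta> > 0"
    and ret: "\<And>n. n \<in> A \<Longrightarrow> lp_dist p y ((pseudo_shift f w ^^ n) x) < r"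
    and j: "1 \<le> j" and r: "r < norm (y j)"
  shows "\<forall>n. weight_prod f w j n \<noteq> 0"
    and "\<exists>B. \<forall>K. (\<Sum>k\<in>{1..K}. 1 / norm (weight_prod f w j k) powr p) \<le> B"
proof -
  let ?T = "pseudo_shift f w"
  let ?W = "weight_prod f w"
  define b where "b = norm (y j) - r"
  have b: "b > 0" using r by (simp add: b_def)
  have x0: "x 0 = 0" using x by (simp add: lp_space_def)
  have Tn: "(?T ^^ n) x \<in> lp_space p" for n by (rule pseudo_shift_funpow_mem_lp[OF fw p x])
  have low: "b \<le> norm (?W j n * x ((f ^^ n) j))" if "n \<in> A" for n
  proof -
    have "norm (y j - (?T ^^ n) x j) \<le> lp_dist p y ((?T ^^ n) x)"
      using norm_coord_le_lp_norm[OF p lp_diff_mem[OF p y Tn]] by (simp add: lp_dist_def)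
    then have "norm (y j - ?W j n * x ((f ^^ n) j)) < r"
      using ret[OF that] j by (simp add: pseudo_shift_funpow_apply[where x = x, OF fw x0])
    then show ?thesis
      using norm_triangle_ineq2[of "y j" "?W j n * x ((f ^^ n) j)"] by (simp add: b_def)
  qed
  show nz: "\<forall>n. ?W j n \<noteq> 0"
  proof
    fix n
    obtain m where m: "m \<in> A" "n \<le> m" using window_dense_infinite[OF dense] by blast
    then have "?W j m \<noteq> 0" using low[OF m(1)] b by auto
    then show "?W j n \<noteq> 0" using m by (rule_tac weight_prod_nonzero_mono)
  qed
  obtain E where E: "E \<ge> 1" "\<And>j. j \<ge> 1 \<Longrightarrow> norm (w j) \<le> E"
    using pseudo_shift_weights_bounded[OF fw] by blast
  define R where "R = lp_norm p y + r"
  have "\<exists>B. \<forall>K. (\<Sum>k\<in>{1..K}. 1 / norm (?W j k) powr p) \<le> B"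
  proof (rule bounded_sums_of_Banach_dense_differences[OF dense])
    show "1 \<le> E powr p" using E p by (simp add: ge_one_powr_ge_zero)
    show "1 / norm (?W j k) powr p \<le> E powr p * (1 / norm (?W j (Suc k)) powr p)" for k
    proof -
      have "norm (?W j (Suc k)) \<le> norm (?W j k) * E"
        unfolding weight_prod_Suc norm_mult using pseudo_shift_data_funpow_ge[OF fw j, of "Suc k"] j
        by (intro mult_left_mono E) auto
      then have "norm (?W j (Suc k)) powr p \<le> (norm (?W j k) * E) powr p"
        using p by (intro powr_mono2) auto
      also have "\<dots> = norm (?W j k) powr p * E powr p"
        using E by (simp add: powr_mult)
      finally show ?thesis using nz by (simp add: field_simps)
    qed
    fix n F assume n: "n \<in> A" and F: "finite F" "F \<subseteq> A \<inter> {n<..}"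
    define \<kappa> where "\<kappa> m = (f ^^ (m - n)) j" for m
    have \<kappa>1: "1 \<le> \<kappa> m" for m
      using pseudo_shift_data_funpow_ge[OF fw j, of "m - n"] j by (simp add: \<kappa>_def)
    have "(\<Sum>m\<in>F. 1 / norm (?W j (m - n)) powr p)
        \<le> (\<Sum>m\<in>F. norm ((?T ^^ n) x (\<kappa> m)) powr p / b powr p)"
    proof (rule sum_mono)
      fix m assume m: "m \<in> F"
      have "?W j m * x ((f ^^ m) j) = ?W j (m - n) * (?T ^^ n) x (\<kappa> m)"
      proof -
        have "(f ^^ n) (\<kappa> m) = (f ^^ m) j" using m F unfolding \<kappa>_def by (intro funpow_diff) auto
        moreover have "?W j m = ?W j (m - n) * ?W (\<kappa> m) n"
          using m F unfolding \<kappa>_def by (intro weight_prod_diff) auto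
        ultimately show ?thesis
          using \<kappa>1 by (simp add: pseudo_shift_funpow_apply[where x = x, OF fw x0] mult.assoc)
      qed
      then have "b \<le> norm (?W j (m - n)) * norm ((?T ^^ n) x (\<kappa> m))"
        using low[of m] m F by (auto simp: norm_mult)
      then have "b powr p \<le> (norm (?W j (m - n)) * norm ((?T ^^ n) x (\<kappa> m))) powr p"
        using b p by (intro powr_mono2) auto
      then show "1 / norm (?W j (m - n)) powr p \<le> norm ((?T ^^ n) x (\<kappa> m)) powr p / b powr p"
        using b nz by (simp add: powr_mult field_simps)
    qed
    also have "\<dots> = (\<Sum>k\<in>\<kappa> ` F. norm ((?T ^^ n) x k) powr p) / b powr p"
    proof -
      have "inj_on \<kappa> F"
      proof (rule inj_onI)
        fix m m' assume "m \<in> F" "m' \<in> F" "\<kappa> m = \<kappa> m'"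
        then have "m - n = m' - n"
          using injD[OF inj_on_funpow_exponent[OF fw j]] unfolding \<kappa>_def by blast
        then show "m = m'" using \<open>m \<in> F\<close> \<open>m' \<in> F\<close> F by auto
      qed
      then show ?thesis by (simp add: sum.reindex sum_divide_distrib)
    qed
    also have "\<dots> \<le> R powr p / b powr p"
    proof -
      have "lp_norm p ((?T ^^ n) x) \<le> R"
      proof -
        have "lp_norm p (\<lambda>i. (?T ^^ n) x i - y i + y i) \<le> lp_norm p (\<lambda>i. (?T ^^ n) x i - y i) + lp_norm p y"
          by (rule lp_minkowski(2)[OF p lp_diff_mem[OF p Tn y] y])
        moreover have "lp_norm p (\<lambda>i. (?T ^^ n) x i - y i) = lp_dist p y ((?T ^^ n) x)"
          by (simp add: lp_dist_def lp_norm_def norm_minus_commute)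
        ultimately show ?thesis using ret[OF n] by (simp add: R_def)
      qed
      then have "(\<Sum>k\<in>\<kappa> ` F. norm ((?T ^^ n) x k) powr p) \<le> R powr p"
        using finite_sum_le_lp_norm[OF p Tn, of "\<kappa> ` F" n] F p
          powr_mono2[of p "lp_norm p ((?T ^^ n) x)" R] by simp
      then show ?thesis by (simp add: divide_right_mono)
    qed
    finally show "(\<Sum>m\<in>F. 1 / norm (?W j (m - n)) powr p) \<le> R powr p / b powr p" .
  qed auto
  then show "\<exists>B. \<forall>K. (\<Sum>k\<in>{1..K}. 1 / norm (?W j k) powr p) \<le> B" .
qed

definition truncate_seq :: "nat \<Rightarrow> (nat \<Rightarrow> 'k::zero) \<Rightarrow> nat \<Rightarrow> 'k" where
  "truncate_seq l y j = (if j \<in> {1..l} then y j else 0)"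

lemma truncate_seq_mem_lp: "truncate_seq l y \<in> lp_space p"
  by (rule finitely_supported_lp_space)
     (auto simp: truncate_seq_def intro: finite_subset[of _ "{1..l}"])

lemma norm_quotient_diff_le:
  fixes u v a b :: "'k::real_normed_field"
  assumes "norm (u - a) \<le> r" "norm (v - b) \<le> r"
    and "\<alpha> \<le> norm b" "norm a \<le> \<beta>" "norm b \<le> \<beta>" and r: "r \<le> \<alpha> / 2" "4 * r * \<beta> \<le> e * \<alpha>\<^sup>2" and "0 < \<alpha>"
  shows "norm (u / v - a / b) \<le> e"
proof -
  have v: "\<alpha> / 2 \<le> norm v" using norm_triangle_ineq2[of b v] assms by (simp add: norm_minus_commute)
  then have nz: "v \<noteq> 0" "b \<noteq> 0" using assms by auto
  have r0: "0 \<le> r" using assms(1) norm_ge_zero order_trans by blast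
  have \<beta>0: "0 \<le> \<beta>" using assms(4) norm_ge_zero order_trans by blast
  have "u / v - a / b = ((u - a) * b - a * (v - b)) / (v * b)"
    using nz by (simp add: field_simps)
  then have "norm (u / v - a / b) = norm ((u - a) * b - a * (v - b)) / (norm v * norm b)"
    by (simp add: norm_divide norm_mult)
  also have "\<dots> \<le> (norm (u - a) * norm b + norm a * norm (v - b)) / (norm v * norm b)"
    using norm_triangle_ineq4[of "(u - a) * b" "a * (v - b)"]
    by (intro divide_right_mono) (auto simp: norm_mult)
  also have "\<dots> \<le> (r * \<beta> + \<beta> * r) / (\<alpha> / 2 * \<alpha>)"
    using assms v r0 \<beta>0 by (intro frac_le add_mono mult_mono) auto
  also have "\<dots> = 4 * r * \<beta> / \<alpha>\<^sup>2" using \<open>0 < \<alpha>\<close> by (simp add: power2_eq_square field_simps)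
  also have "\<dots> \<le> e" using r \<open>0 < \<alpha>\<close> by (simp add: divide_simps)
  finally show ?thesis .
qed

text \<open>
  At common return times to balls around vectors supported on \<open>[l]\<close>, both conditions of (2) can be
  read off. Outside \<open>[l]\<close> the vectors \<open>T\<^sub>s\<^sup>n x\<close> are small, and their entries at \<open>f\<^sub>s\<^sup>-\<^sup>n (f\<^sub>t\<^sup>m j)\<close> are, up
  to the factor \<open>W\<^sup>t\<^sub>j\<^sub>,\<^sub>m x (f\<^sub>t\<^sup>m j) \<approx> a\<^sub>t\<^sub>,\<^sub>j\<close>, the \<open>p\<close>-th roots of the terms of (a) in modulus. Inside \<open>[l]\<close>, if \<open>f\<^sub>s\<^sup>n i = f\<^sub>t\<^sup>n j\<close> then
  the same entry of \<open>x\<close> multiplied by the two weights must approximate \<open>a\<^sub>s\<^sub>,\<^sub>i\<close> and \<open>a\<^sub>t\<^sub>,\<^sub>j\<close>, which gives (b).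
\<close>

lemma weight_conditions_of_returns:
  fixes f :: "nat \<Rightarrow> nat \<Rightarrow> nat" and w a :: "nat \<Rightarrow> nat \<Rightarrow> 'k::real_normed_field"
  assumes p: "1 \<le> p" and x: "x \<in> lp_space p"
    and fw: "pseudo_shift_data (f s) (w s)" "pseudo_shift_data (f t) (w t)"
    and nz: "\<And>j n. 1 \<le> j \<Longrightarrow> weight_prod (f t) (w t) j n \<noteq> 0"
    and ret: "\<And>u n. u \<in> {s, t} \<Longrightarrow> n \<in> A \<Longrightarrow>
        lp_dist p (truncate_seq l (a u)) ((pseudo_shift (f u) (w u) ^^ n) x) \<le> r"
    and a: "\<And>u j. u \<in> {s, t} \<Longrightarrow> j \<in> {1..l} \<Longrightarrow> \<alpha> \<le> norm (a u j) \<and> norm (a u j) \<le> \<beta>"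
    and \<alpha>: "0 < \<alpha>" and r: "0 \<le> r" "2 * r \<le> \<alpha>" "2 * r \<le> \<alpha> * \<epsilon>" "4 * r * \<beta> \<le> \<epsilon> * \<alpha>\<^sup>2"
    and n: "n \<in> A"
  shows "\<And>j F. \<lbrakk>j \<in> {1..l}; finite F; F \<subseteq> {m\<in>A. (f t ^^ m) j \<in> (f s ^^ n) ` {l<..}}\<rbrakk> \<Longrightarrow>
      (\<Sum>m\<in>F. norm (weight_prod (f s) (w s) (iter_inv (f s) n ((f t ^^ m) j)) n) powr p
         / norm (weight_prod (f t) (w t) j m) powr p) \<le> \<epsilon>"
    and "\<And>i j. \<lbrakk>i \<in> {1..l}; j \<in> {1..l}; (f s ^^ n) i = (f t ^^ n) j\<rbrakk> \<Longrightarrow>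
      norm (weight_prod (f s) (w s) i n / weight_prod (f t) (w t) j n - a s i / a t j) \<le> \<epsilon>"
proof -
  let ?T = "\<lambda>u. pseudo_shift (f u) (w u)"
  let ?W = "\<lambda>u. weight_prod (f u) (w u)"
  have fwu: "pseudo_shift_data (f u) (w u)" if "u \<in> {s, t}" for u using fw that by auto
  have x0: "x 0 = 0" using x by (simp add: lp_space_def)
  have Tn: "(?T u ^^ n) x \<in> lp_space p" if "u \<in> {s, t}" for u n
    by (rule pseudo_shift_funpow_mem_lp[OF fwu[OF that] p x])
  have entry: "norm (?W u j n * x ((f u ^^ n) j) - a u j) \<le> r"
    if u: "u \<in> {s, t}" and "n \<in> A" "j \<in> {1..l}" for u n j
  proof -
    have "norm (truncate_seq l (a u) j - (?T u ^^ n) x j) \<le> lp_dist p (truncate_seq l (a u)) ((?T u ^^ n) x)"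
      using norm_coord_le_lp_norm[OF p lp_diff_mem[OF p truncate_seq_mem_lp Tn[OF u]]]
      by (simp add: lp_dist_def)
    then show ?thesis
      using ret[OF u \<open>n \<in> A\<close>] that
      by (simp add: pseudo_shift_funpow_apply[where x = x, OF fwu[OF u] x0] truncate_seq_def norm_minus_commute)
  qed
  show "norm (?W s i n / ?W t j n - a s i / a t j) \<le> \<epsilon>"
    if ij: "i \<in> {1..l}" "j \<in> {1..l}" "(f s ^^ n) i = (f t ^^ n) j" for i j
  proof -
    define X where "X = x ((f t ^^ n) j)"
    have e: "norm (?W s i n * X - a s i) \<le> r" "norm (?W t j n * X - a t j) \<le> r"
      using entry[of s n i] entry[of t n j] n ij by (auto simp: X_def)
    have "X \<noteq> 0" using e(2) a[of t j] ij r \<alpha> by auto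
    then have "?W s i n / ?W t j n = (?W s i n * X) / (?W t j n * X)" by simp
    moreover have "norm ((?W s i n * X) / (?W t j n * X) - a s i / a t j) \<le> \<epsilon>"
      using a[of t j] a[of s i] ij r \<alpha> by (intro norm_quotient_diff_le[OF e, of \<alpha> \<beta>]) auto
    ultimately show ?thesis by simp
  qed
  show "(\<Sum>m\<in>F. norm (?W s (iter_inv (f s) n ((f t ^^ m) j)) n) powr p / norm (?W t j m) powr p) \<le> \<epsilon>"
    if j: "j \<in> {1..l}" and F: "finite F" "F \<subseteq> {m\<in>A. (f t ^^ m) j \<in> (f s ^^ n) ` {l<..}}" for j F
  proof -
    define \<kappa> where "\<kappa> m = iter_inv (f s) n ((f t ^^ m) j)" for m
    have \<kappa>: "l < \<kappa> m" "(f s ^^ n) (\<kappa> m) = (f t ^^ m) j" if m: "m \<in> F" for m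
    proof -
      obtain k where "l < k" "(f t ^^ m) j = (f s ^^ n) k" using F m by auto
      moreover have "\<kappa> m = k"
        unfolding \<kappa>_def calculation(2) using calculation(1) by (intro iter_inv_funpow[OF fw(1)]) simp
      ultimately show "l < \<kappa> m" "(f s ^^ n) (\<kappa> m) = (f t ^^ m) j" by auto
    qed
    let ?d = "\<lambda>k. truncate_seq l (a s) k - (?T s ^^ n) x k"
    have d: "?d \<in> lp_space p" by (rule lp_diff_mem[OF p truncate_seq_mem_lp Tn]) simp
    have "(\<Sum>m\<in>F. norm (?W s (\<kappa> m) n) powr p / norm (?W t j m) powr p)
        \<le> (\<Sum>m\<in>F. (2 / \<alpha>) powr p * norm (?d (\<kappa> m)) powr p)"
    proof (rule sum_mono)
      fix m assume m: "m \<in> F"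
      have mA: "m \<in> A" using m F by auto
      define X where "X = x ((f t ^^ m) j)"
      have "norm (?W t j m * X - a t j) \<le> r" unfolding X_def using entry[of t m j] mA j by simp
      then have "\<alpha> / 2 \<le> norm (?W t j m) * norm X"
        using norm_triangle_ineq2[of "a t j" "?W t j m * X"] a[of t j] j r
        by (simp add: norm_minus_commute norm_mult)
      then have "1 / norm (?W t j m) \<le> 2 / \<alpha> * norm X"
        using nz[of j m] j \<alpha> by (simp add: field_simps)
      then have "norm (?W s (\<kappa> m) n) * (1 / norm (?W t j m)) \<le> norm (?W s (\<kappa> m) n) * (2 / \<alpha> * norm X)"
        by (intro mult_left_mono) auto
      also have "\<dots> = 2 / \<alpha> * norm (?d (\<kappa> m))"
        using \<kappa>[OF m]
        by (simp add: X_def truncate_seq_def pseudo_shift_funpow_apply[where x = x, OF fw(1) x0] norm_mult)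
      finally have "(norm (?W s (\<kappa> m) n) / norm (?W t j m)) powr p \<le> (2 / \<alpha> * norm (?d (\<kappa> m))) powr p"
        using p by (intro powr_mono2) auto
      then show "norm (?W s (\<kappa> m) n) powr p / norm (?W t j m) powr p
          \<le> (2 / \<alpha>) powr p * norm (?d (\<kappa> m)) powr p"
        using \<alpha> by (simp add: powr_divide powr_mult)
    qed
    also have "\<dots> = (2 / \<alpha>) powr p * (\<Sum>k\<in>\<kappa> ` F. norm (?d k) powr p)"
    proof -
      have "inj_on \<kappa> F"
      proof (rule inj_onI)
        fix m m' assume "m \<in> F" "m' \<in> F" "\<kappa> m = \<kappa> m'"
        then have "(f t ^^ m) j = (f t ^^ m') j" using \<kappa> by metis
        then show "m = m'" using injD[OF inj_on_funpow_exponent[OF fw(2), of j]] j by auto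
      qed
      then show ?thesis by (simp add: sum.reindex sum_distrib_left)
    qed
    also have "\<dots> \<le> (2 / \<alpha>) powr p * lp_norm p ?d powr p"
      using F by (intro mult_left_mono finite_sum_le_lp_norm[OF p d]) auto
    also have "\<dots> = (2 / \<alpha> * lp_norm p ?d) powr p"
      using \<alpha> by (subst powr_mult) auto
    also have "\<dots> \<le> (2 / \<alpha> * r) powr p"
      using ret[of s n] n \<alpha> p unfolding lp_dist_def by (intro powr_mono2 mult_left_mono) auto
    also have "\<dots> \<le> (2 / \<alpha> * r) powr 1"
      using \<alpha> p r by (intro powr_mono') auto
    also have "\<dots> \<le> \<epsilon>" using \<alpha> r by (simp add: field_simps)
    finally show ?thesis unfolding \<kappa>_def .
  qed
qed

section \<open>Sufficiency: interpolating vectors\<close>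

lemma finite_triple_slice: "finite D \<Longrightarrow> finite {m. (t, j, m) \<in> D}"
  by (rule finite_subset[of _ "(\<lambda>(t, j, m). m) ` D"]) force+

lemma sum_triples_le:
  fixes g :: "'a \<times> 'b \<times> 'c \<Rightarrow> real"
  assumes "finite D" "D \<subseteq> S \<times> R \<times> UNIV" "finite S" "finite R"
    and "\<And>t j. t \<in> S \<Longrightarrow> j \<in> R \<Longrightarrow> (\<Sum>m\<in>{m. (t, j, m) \<in> D}. g (t, j, m)) \<le> b"
  shows "sum g D \<le> real (card S) * real (card R) * b"
proof -
  have "D = Sigma S (\<lambda>t. Sigma R (\<lambda>j. {m. (t, j, m) \<in> D}))" using assms(2) by auto
  then have "sum g D = (\<Sum>t\<in>S. \<Sum>j\<in>R. \<Sum>m\<in>{m. (t, j, m) \<in> D}. g (t, j, m))"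
    using assms(1,3,4) by (simp add: sum.Sigma finite_triple_slice)
  also have "\<dots> \<le> (\<Sum>t\<in>S. \<Sum>j\<in>R. b)" using assms(5) by (intro sum_mono)
  finally show ?thesis by (simp add: mult.assoc)
qed

text \<open>
  The vector \<open>x\<close> agrees with \<open>x0\<close> on its finite support and has the entry \<open>y\<^sub>t\<^sub>,\<^sub>j / W\<^sup>t\<^sub>j\<^sub>,\<^sub>m\<close> at the position
  \<open>f\<^sub>t\<^sup>m j\<close>, for \<open>m \<in> A\<close> large and \<open>j \<le> l\<close>. A position can be claimed by several pairs \<open>(t, j)\<close>, but only
  by one \<open>m\<close>, and then any choice of the pair works, because hypothesis \<open>match\<close> makes the competing values
  nearly proportional to what each operator needs. Entries of \<open>T\<^sub>s\<^sup>n x\<close> outside \<open>[l]\<close> come from positions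
  \<open>f\<^sub>t\<^sup>m j = f\<^sub>s\<^sup>n k\<close> with \<open>k > l\<close>: for \<open>t \<noteq> s\<close> they are controlled by \<open>cross\<close>; for \<open>t = s\<close> the cocycle identity
  for the weight products turns them into \<open>y\<^sub>s\<^sub>,\<^sub>j / W\<^sup>s\<^sub>j\<^sub>,\<^sub>m\<^sub>-\<^sub>n\<close>, controlled by \<open>same\<close>.
  The error inside \<open>[l]\<close> has at most \<open>l\<close> entries and the one outside splits into \<open>N l\<close> sums, whence the factor
  \<open>(N + 1) l\<close>.
\<close>

lemma interpolating_vector:
  fixes f :: "nat \<Rightarrow> nat \<Rightarrow> nat" and w y :: "nat \<Rightarrow> nat \<Rightarrow> 'k::real_normed_field"
  assumes p: "1 \<le> p" and fw: "\<And>s. s \<in> {1..N} \<Longrightarrow> pseudo_shift_data (f s) (w s)"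
    and nz: "\<And>s j n. s \<in> {1..N} \<Longrightarrow> 1 \<le> j \<Longrightarrow> weight_prod (f s) (w s) j n \<noteq> 0"
    and y: "\<And>s j. s \<in> {1..N} \<Longrightarrow> j \<in> {1..l} \<Longrightarrow> y s j \<noteq> 0 \<and> norm (y s j) \<le> C"
    and C: "0 \<le> C" and \<epsilon>: "0 \<le> \<epsilon>" "\<epsilon> \<le> 1"
    and disj: "\<And>m n s t i j. \<lbrakk>m \<in> A; n \<in> A; s \<in> {1..N}; t \<in> {1..N}; i \<in> {1..l}; j \<in> {1..l};
        (f s ^^ m) i = (f t ^^ n) j\<rbrakk> \<Longrightarrow> m = n"
    and same: "\<And>s j n F. \<lbrakk>s \<in> {1..N}; j \<in> {1..l}; n \<in> A; finite F; F \<subseteq> A \<inter> {n<..}\<rbrakk> \<Longrightarrow>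
        (\<Sum>m\<in>F. 1 / norm (weight_prod (f s) (w s) j (m - n)) powr p) \<le> \<epsilon>"
    and cross: "\<And>s t j n F. \<lbrakk>s \<in> {1..N}; t \<in> {1..N}; s \<noteq> t; j \<in> {1..l}; n \<in> A; finite F;
        F \<subseteq> {m\<in>A. (f t ^^ m) j \<in> (f s ^^ n) ` {l<..}}\<rbrakk> \<Longrightarrow>
        (\<Sum>m\<in>F. norm (weight_prod (f s) (w s) (iter_inv (f s) n ((f t ^^ m) j)) n) powr p
           / norm (weight_prod (f t) (w t) j m) powr p) \<le> \<epsilon>"
    and match: "\<And>s t i j n. \<lbrakk>s \<in> {1..N}; t \<in> {1..N}; s \<noteq> t; n \<in> A; i \<in> {1..l}; j \<in> {1..l};
        (f s ^^ n) i = (f t ^^ n) j\<rbrakk> \<Longrightarrow>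
        norm (weight_prod (f s) (w s) i n / weight_prod (f t) (w t) j n - y s i / y t j) \<le> \<epsilon>"
    and x0: "x0 \<in> lp_space p" "\<And>i. L < i \<Longrightarrow> x0 i = 0" and m0: "L \<le> m0"
    and start: "\<And>s j F. \<lbrakk>s \<in> {1..N}; j \<in> {1..l}; finite F; F \<subseteq> A \<inter> {m0..}\<rbrakk> \<Longrightarrow>
        (\<Sum>m\<in>F. 1 / norm (weight_prod (f s) (w s) j m) powr p) \<le> \<epsilon>'"
    and \<rho>: "0 \<le> \<rho>" "real N * real l * (C powr p * \<epsilon>') \<le> \<rho> powr p"
    and \<eta>: "0 \<le> \<eta>" "real (Suc N) * real l * (C powr p * \<epsilon>) \<le> \<eta> powr p"
  shows "\<exists>x\<in>lp_space p. lp_dist p x0 x \<le> \<rho> \<and>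
     (\<forall>n\<in>A \<inter> {m0..}. \<forall>s\<in>{1..N}.
        lp_dist p (truncate_seq l (y s)) ((pseudo_shift (f s) (w s) ^^ n) x) \<le> \<eta>)"
proof -
  let ?T = "\<lambda>s. pseudo_shift (f s) (w s)"
  let ?W = "\<lambda>s. weight_prod (f s) (w s)"
  define D where "D = {1..N} \<times> {1..l} \<times> (A \<inter> {m0..})"
  define pos where "pos = (\<lambda>(t, j, m). (f t ^^ m) j)"
  define val where "val = (\<lambda>(t, j, m). y t j / ?W t j m)"
  define \<tau> where "\<tau> = inv_into D pos"
  define P where "P = pos ` D"
  define x where "x i = (if i \<in> P then val (\<tau> i) else x0 i)" for i
  have \<tau>: "\<tau> i \<in> D" "pos (\<tau> i) = i" if "i \<in> P" for i
    using that by (auto simp: \<tau>_def P_def inv_into_into f_inv_into_f)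
  have \<tau>_inj: "inj_on \<tau> P" by (metis \<tau>(2) inj_onI)
  have \<tau>_cases: "\<exists>t\<in>{1..N}. \<exists>j\<in>{1..l}. \<exists>m\<in>A. m0 \<le> m \<and> \<tau> i = (t, j, m) \<and> i = (f t ^^ m) j"
    if "i \<in> P" for i
    using \<tau>[OF that] by (auto simp: D_def pos_def)
  have \<tau>_sub: "\<tau> ` P \<subseteq> {1..N} \<times> {1..l} \<times> UNIV" using \<tau>(1) by (fastforce simp: D_def)
  have P_gt: "L < i" if i: "i \<in> P" for i
  proof -
    obtain t j m where "t \<in> {1..N}" "j \<in> {1..l}" "m0 \<le> m" "i = (f t ^^ m) j"
      using \<tau>_cases[OF i] by blast
    then show ?thesis
      using pseudo_shift_data_funpow_ge[OF fw, of t j m] m0 by auto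
  qed
  have x0P: "x0 i = 0" if "i \<in> P" for i using x0(2) P_gt[OF that] by blast
  have x00: "x0 0 = 0" using x0(1) by (simp add: lp_space_def)
  have val_le: "norm (val (t, j, m)) powr p \<le> C powr p * (1 / norm (?W t j m) powr p)"
    if "t \<in> {1..N}" "j \<in> {1..l}" for t j m
    using y[OF that] p
    by (auto simp: val_def norm_divide powr_divide intro!: divide_right_mono powr_mono2)
  have dist0: "(\<lambda>i. x0 i - x i) \<in> lp_space p \<and> lp_norm p (\<lambda>i. x0 i - x i) \<le> \<rho>"
  proof -
    have "(\<Sum>i\<in>F. norm (x0 i - x i) powr p) \<le> \<rho> powr p" if F: "finite F" for F
    proof -
      have "(\<Sum>i\<in>F. norm (x0 i - x i) powr p) = (\<Sum>i\<in>F \<inter> P. norm (val (\<tau> i)) powr p)"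
        using F x0P by (intro sum.mono_neutral_cong_right) (auto simp: x_def)
      also have "\<dots> = (\<Sum>d\<in>\<tau> ` (F \<inter> P). norm (val d) powr p)"
        using \<tau>_inj by (subst sum.reindex) (auto intro: inj_on_subset)
      also have "\<dots> \<le> real (card {1..N}) * real (card {1..l}) * (C powr p * \<epsilon>')"
      proof (rule sum_triples_le)
        fix t j assume tj: "t \<in> {1..N}" "j \<in> {1..l}"
        define M where "M = {m. (t, j, m) \<in> \<tau> ` (F \<inter> P)}"
        have fM: "finite M" using F by (simp add: M_def finite_triple_slice)
        have M: "M \<subseteq> A \<inter> {m0..}"
        proof
          fix m assume "m \<in> M"
          then obtain i where "i \<in> P" "\<tau> i = (t, j, m)" by (auto simp: M_def)
          then show "m \<in> A \<inter> {m0..}" using \<tau>(1)[of i] by (simp add: D_def)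
        qed
        have "(\<Sum>m\<in>M. norm (val (t, j, m)) powr p) \<le> (\<Sum>m\<in>M. C powr p * (1 / norm (?W t j m) powr p))"
          by (intro sum_mono val_le tj)
        also have "\<dots> \<le> C powr p * \<epsilon>'"
          unfolding sum_distrib_left[symmetric] by (intro mult_left_mono start tj M fM) auto
        finally show "(\<Sum>m\<in>{m. (t, j, m) \<in> \<tau> ` (F \<inter> P)}. norm (val (t, j, m)) powr p) \<le> C powr p * \<epsilon>'"
          unfolding M_def .
      next
        show "\<tau> ` (F \<inter> P) \<subseteq> {1..N} \<times> {1..l} \<times> UNIV" using \<tau>_sub by blast
      qed (use F in auto)
      finally show ?thesis using \<rho> by simp
    qed
    moreover have "x0 0 - x 0 = 0" using x00 P_gt[of 0] by (auto simp: x_def)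
    ultimately show ?thesis using lp_boundI[OF p, of "\<lambda>i. x0 i - x i" \<rho>] \<rho>(1) by blast
  qed
  have x_mem: "x \<in> lp_space p"
    using lp_diff_mem[OF p x0(1), of "\<lambda>i. x0 i - x i"] dist0 by simp
  have x_0: "x 0 = 0" using x_mem by (simp add: lp_space_def)
  have "lp_dist p (truncate_seq l (y s)) ((?T s ^^ n) x) \<le> \<eta>"
    if n: "n \<in> A" "m0 \<le> n" and s: "s \<in> {1..N}" for n s
  proof -
    have Tx: "(?T s ^^ n) x k = ?W s k n * x ((f s ^^ n) k)" if "1 \<le> k" for k
      using that by (simp add: pseudo_shift_funpow_apply[where x = x, OF fw[OF s] x_0])
    let ?d = "\<lambda>k. truncate_seq l (y s) k - (?T s ^^ n) x k"
    have low: "norm (?d k) powr p \<le> C powr p * \<epsilon>" if k: "k \<in> {1..l}" for k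
    proof -
      let ?i = "(f s ^^ n) k"
      have "pos (s, k, n) \<in> P" using s k n unfolding P_def by (intro imageI) (auto simp: D_def)
      then have iP: "?i \<in> P" by (simp add: pos_def)
      obtain t j m where tjm: "t \<in> {1..N}" "j \<in> {1..l}" "m \<in> A" "\<tau> ?i = (t, j, m)" "?i = (f t ^^ m) j"
        using \<tau>_cases[OF iP] by blast
      have mn: "n = m" using disj[OF n(1) tjm(3) s tjm(1) k tjm(2) tjm(5)] .
      have Tk: "(?T s ^^ n) x k = ?W s k n * (y t j / ?W t j n)"
        using k iP tjm(4) mn by (subst Tx) (simp_all add: x_def val_def)
      have "norm (?d k) \<le> C * \<epsilon>"
      proof (cases "s = t")
        case True
        have "k = j"
          using True tjm k mn by (intro pseudo_shift_data_funpow_inj[OF fw[OF s], of k j n]) auto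
        then have "?d k = 0" using True k Tk nz[OF s, of k n] by (simp add: truncate_seq_def)
        then show ?thesis using C \<epsilon> by simp
      next
        case False
        have "norm (?W s k n / ?W t j n - y s k / y t j) \<le> \<epsilon>"
          using match[OF s tjm(1) False n(1) k tjm(2)] tjm(5) mn by simp
        moreover have "?d k = - (y t j * (?W s k n / ?W t j n - y s k / y t j))"
          using k Tk y[OF tjm(1,2)] by (simp add: truncate_seq_def algebra_simps)
        ultimately show ?thesis
          using y[OF tjm(1,2)] C by (simp add: norm_mult mult_mono)
      qed
      then have "norm (?d k) powr p \<le> (C * \<epsilon>) powr p" using p by (intro powr_mono2) auto
      also have "\<dots> = C powr p * \<epsilon> powr p" using C \<epsilon> by (simp add: powr_mult)
      also have "\<epsilon> powr p \<le> \<epsilon> powr 1" using p \<epsilon> by (intro powr_mono') auto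
      finally show ?thesis using \<epsilon> by (simp add: mult_left_mono)
    qed
    have high: "(\<Sum>k\<in>F. norm (?d k) powr p) \<le> real N * real l * (C powr p * \<epsilon>)"
      if F: "finite F" "F \<subseteq> {l<..}" for F
    proof -
      define F' where "F' = {k\<in>F. (f s ^^ n) k \<in> P}"
      define \<sigma> where "\<sigma> k = \<tau> ((f s ^^ n) k)" for k
      define g where "g d = norm (?W s (iter_inv (f s) n (pos d)) n * val d) powr p" for d
      have zero: "x ((f s ^^ n) k) = 0" if "k \<in> F - F'" for k
      proof -
        have "k + n \<le> (f s ^^ n) k" using that F by (intro pseudo_shift_data_funpow_ge[OF fw[OF s]]) auto
        then have "L < (f s ^^ n) k" using that F n m0 by auto
        then show ?thesis using that x0(2) by (simp add: x_def F'_def)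
      qed
      have inv_\<sigma>: "iter_inv (f s) n (pos (\<sigma> k)) = k" if "k \<in> F'" for k
        using that F \<tau>(2)[of "(f s ^^ n) k"] iter_inv_funpow[OF fw[OF s], of k n]
        by (auto simp: \<sigma>_def F'_def)
      have "(\<Sum>k\<in>F. norm (?d k) powr p) = (\<Sum>k\<in>F'. g (\<sigma> k))"
      proof (rule sum.mono_neutral_cong_right)
        show "\<forall>k\<in>F - F'. norm (?d k) powr p = 0"
          using zero F by (auto simp: truncate_seq_def Tx subset_eq Suc_le_eq)
        show "norm (?d k) powr p = g (\<sigma> k)" if "k \<in> F'" for k
        proof -
          have "l < k" "(f s ^^ n) k \<in> P" using that F by (auto simp: F'_def)
          then show ?thesis
            using inv_\<sigma>[OF that] by (simp add: truncate_seq_def Tx g_def x_def) (simp add: \<sigma>_def)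
        qed
      qed (use F in \<open>auto simp: F'_def\<close>)
      also have "\<dots> = sum g (\<sigma> ` F')"
        by (subst sum.reindex) (auto intro: inj_on_inverseI[of _ "\<lambda>d. iter_inv (f s) n (pos d)"] inv_\<sigma>)
      also have "\<dots> \<le> real (card {1..N}) * real (card {1..l}) * (C powr p * \<epsilon>)"
      proof (rule sum_triples_le)
        show "finite (\<sigma> ` F')" using F by (auto simp: F'_def)
        show "\<sigma> ` F' \<subseteq> {1..N} \<times> {1..l} \<times> UNIV"
          using \<tau>_sub by (auto simp: \<sigma>_def F'_def)
        fix t j assume tj: "t \<in> {1..N}" "j \<in> {1..l}"
        define M where "M = {m. (t, j, m) \<in> \<sigma> ` F'}"
        have fM: "finite M" using F by (simp add: M_def F'_def finite_triple_slice)
        have M: "m \<in> A \<and> (\<exists>k>l. (f t ^^ m) j = (f s ^^ n) k)" if "m \<in> M" for m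
        proof -
          obtain k where k: "k \<in> F'" "\<sigma> k = (t, j, m)" using \<open>m \<in> M\<close> by (auto simp: M_def)
          then have "(t, j, m) \<in> D" "pos (t, j, m) = (f s ^^ n) k"
            using \<tau>[of "(f s ^^ n) k"] by (auto simp: \<sigma>_def F'_def)
          then show ?thesis using k F by (auto simp: D_def pos_def F'_def)
        qed
        have "(\<Sum>m\<in>M. g (t, j, m))
            \<le> (\<Sum>m\<in>M. C powr p * (norm (?W s (iter_inv (f s) n ((f t ^^ m) j)) n) powr p
                  / norm (?W t j m) powr p))"
        proof (rule sum_mono)
          fix m
          have "norm (?W s (iter_inv (f s) n ((f t ^^ m) j)) n) powr p * norm (val (t, j, m)) powr p
             \<le> norm (?W s (iter_inv (f s) n ((f t ^^ m) j)) n) powr p * (C powr p * (1 / norm (?W t j m) powr p))"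
            by (intro mult_left_mono val_le tj) auto
          then show "g (t, j, m) \<le> C powr p * (norm (?W s (iter_inv (f s) n ((f t ^^ m) j)) n) powr p
                  / norm (?W t j m) powr p)"
            by (simp add: g_def pos_def norm_mult powr_mult mult_ac)
        qed
        also have "\<dots> = C powr p * (\<Sum>m\<in>M. norm (?W s (iter_inv (f s) n ((f t ^^ m) j)) n) powr p
                  / norm (?W t j m) powr p)"
          by (simp add: sum_distrib_left)
        also have "\<dots> \<le> C powr p * \<epsilon>"
        proof (rule mult_left_mono)
          show "(\<Sum>m\<in>M. norm (?W s (iter_inv (f s) n ((f t ^^ m) j)) n) powr p
                  / norm (?W t j m) powr p) \<le> \<epsilon>"
          proof (cases "s = t")
            case False
            show ?thesis
              using M by (intro cross[OF s tj(1) False tj(2) n(1) fM]) blast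
          next
            case True
            have eq: "n < m \<and> norm (?W s (iter_inv (f s) n ((f t ^^ m) j)) n) powr p / norm (?W t j m) powr p
                = 1 / norm (?W s j (m - n)) powr p" if m: "m \<in> M" for m
            proof -
              obtain k where k: "l < k" "(f s ^^ m) j = (f s ^^ n) k" using M[OF m] True by auto
              have jk: "1 \<le> j" "j < k" using tj k by auto
              note nm = funpow_eq_funpow_cases[OF fw[OF s] jk k(2)]
              have "iter_inv (f s) n ((f t ^^ m) j) = k"
                using k True jk iter_inv_funpow[OF fw[OF s], of k n] by simp
              moreover have "?W t j m = ?W s j (m - n) * ?W s k n"
                using weight_prod_diff[of n m "f s" "w s" j] nm True by simp
              moreover have "?W s k n \<noteq> 0" using nz[OF s, of k n] jk by simp
              ultimately show ?thesis using nm(1) by (simp add: norm_mult powr_mult)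
            qed
            have "(\<Sum>m\<in>M. norm (?W s (iter_inv (f s) n ((f t ^^ m) j)) n) powr p / norm (?W t j m) powr p)
                = (\<Sum>m\<in>M. 1 / norm (?W s j (m - n)) powr p)"
              using eq by (intro sum.cong) auto
            also have "\<dots> \<le> \<epsilon>" using eq M by (intro same[OF s tj(2) n(1) fM]) auto
            finally show ?thesis .
          qed
        qed auto
        finally show "(\<Sum>m\<in>{m. (t, j, m) \<in> \<sigma> ` F'}. g (t, j, m)) \<le> C powr p * \<epsilon>"
          unfolding M_def .
      qed auto
      finally show ?thesis by simp
    qed
    show ?thesis
      unfolding lp_dist_def
    proof (rule lp_boundI(2)[OF p])
      show "truncate_seq l (y s) 0 - (?T s ^^ n) x 0 = 0"
        by (simp add: truncate_seq_def pseudo_shift_funpow_apply[where x = x, OF fw[OF s] x_0])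
      fix F :: "nat set" assume F: "finite F"
      have "F = (F \<inter> {1..l}) \<union> (F \<inter> {l<..}) \<union> (F \<inter> {0})" by force
      then have "(\<Sum>k\<in>F. norm (?d k) powr p) = (\<Sum>k\<in>(F \<inter> {1..l}) \<union> (F \<inter> {l<..}). norm (?d k) powr p)"
        using F \<open>truncate_seq l (y s) 0 - (?T s ^^ n) x 0 = 0\<close>
        by (intro sum.mono_neutral_right) auto
      also have "\<dots> = (\<Sum>k\<in>F \<inter> {1..l}. norm (?d k) powr p) + (\<Sum>k\<in>F \<inter> {l<..}. norm (?d k) powr p)"
        using F by (intro sum.union_disjoint) auto
      also have "\<dots> \<le> real (card (F \<inter> {1..l})) * (C powr p * \<epsilon>) + real N * real l * (C powr p * \<epsilon>)"
        using F low by (intro add_mono high sum_bounded_above) auto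
      also have "\<dots> \<le> real l * (C powr p * \<epsilon>) + real N * real l * (C powr p * \<epsilon>)"
        using card_mono[of "{1..l}" "F \<inter> {1..l}"] \<epsilon> by (intro add_mono mult_right_mono) auto
      also have "\<dots> \<le> \<eta> powr p" using \<eta>(2) by (simp add: algebra_simps)
      finally show "(\<Sum>k\<in>F. norm (?d k) powr p) \<le> \<eta> powr p" .
    qed (rule \<eta>)
  qed
  then show ?thesis using x_mem dist0 by (intro bexI[of _ x]) (auto simp: lp_dist_def)
qed

section \<open>Sufficiency: the category argument\<close>

text \<open>
  With \<open>D\<close> a countable dense set of nonzero scalars, this provides countably many tuples of balls such that every
  tuple of non-empty open sets contains one of them. The length \<open>l\<close> is common to all operators, as in
  condition (2), and \<open>0\<close> has to be left out of \<open>D\<close> because (2) only concerns nonzero \<open>a\<^sub>s\<^sub>,\<^sub>j\<close>.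
\<close>

lemma lp_targets_dense:
  fixes v :: "nat \<Rightarrow> nat \<Rightarrow> 'k::real_normed_vector"
  assumes p: "1 \<le> p" and v: "\<And>s. s \<in> {1..N} \<Longrightarrow> v s \<in> lp_space p" and r: "0 < r"
    and D: "\<And>z e. 0 < e \<Longrightarrow> \<exists>d\<in>D. norm (z - d) < e"
  shows "\<exists>l\<ge>1. \<exists>y. (\<forall>s\<in>{1..N}. \<forall>j\<in>{1..l}. y s j \<in> D) \<and>
    (\<forall>s\<in>{1..N}. lp_dist p (v s) (truncate_seq l (y s)) \<le> r)"
proof -
  have rp: "(r/2) powr p > 0" using r by simp
  have "\<exists>L. \<forall>F. finite F \<longrightarrow> F \<subseteq> {L<..} \<longrightarrow> (\<Sum>j\<in>F. norm (v s j) powr p) < (r/2) powr p"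
    if "s \<in> {1..N}" for s
    using v[OF that] rp by (intro summable_tail_small) (auto simp: lp_space_def)
  then obtain L where L: "\<And>s F. \<lbrakk>s \<in> {1..N}; finite F; F \<subseteq> {L s<..}\<rbrakk> \<Longrightarrow>
      (\<Sum>j\<in>F. norm (v s j) powr p) < (r/2) powr p"
    by metis
  define l where "l = Max (insert 1 (L ` {1..N}))"
  have l: "1 \<le> l" "\<And>s. s \<in> {1..N} \<Longrightarrow> L s \<le> l"
    unfolding l_def by (auto intro!: Max_ge simp del: Max_insert)
  have "\<exists>d. d \<in> D \<and> norm (v s j - d) < r / (2 * real l)" for s j
    using D[of "r / (2 * real l)" "v s j"] r l(1) by auto
  then obtain y where y: "\<And>s j. y s j \<in> D" "\<And>s j. norm (v s j - y s j) < r / (2 * real l)"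
    by metis
  have "lp_dist p (v s) (truncate_seq l (y s)) \<le> r" if s: "s \<in> {1..N}" for s
    unfolding lp_dist_def
  proof (rule lp_boundI(2)[OF p])
    show v0: "v s 0 - truncate_seq l (y s) 0 = 0"
      using v[OF s] by (simp add: lp_space_def truncate_seq_def)
    let ?d = "\<lambda>k. v s k - truncate_seq l (y s) k"
    fix F :: "nat set" assume F: "finite F"
    have "F = (F \<inter> {1..l}) \<union> (F \<inter> {l<..}) \<union> (F \<inter> {0})" by force
    then have "(\<Sum>k\<in>F. norm (?d k) powr p) = (\<Sum>k\<in>(F \<inter> {1..l}) \<union> (F \<inter> {l<..}). norm (?d k) powr p)"
      using F v0 by (intro sum.mono_neutral_right) auto
    also have "\<dots> = (\<Sum>k\<in>F \<inter> {1..l}. norm (?d k) powr p) + (\<Sum>k\<in>F \<inter> {l<..}. norm (?d k) powr p)"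
      using F by (intro sum.union_disjoint) auto
    also have "(\<Sum>k\<in>F \<inter> {l<..}. norm (?d k) powr p) = (\<Sum>k\<in>F \<inter> {l<..}. norm (v s k) powr p)"
      by (intro sum.cong) (auto simp: truncate_seq_def)
    also have "(\<Sum>k\<in>F \<inter> {l<..}. norm (v s k) powr p) \<le> (r/2) powr p"
      using L[of s "F \<inter> {l<..}"] s F l(2)[OF s] by force
    also have "(\<Sum>k\<in>F \<inter> {1..l}. norm (?d k) powr p) \<le> real (card (F \<inter> {1..l})) * (r / (2 * real l)) powr p"
      using y(2) p F by (intro sum_bounded_above powr_mono2) (auto simp: truncate_seq_def less_imp_le)
    also have "\<dots> \<le> real l * (r / (2 * real l)) powr p"
      using card_mono[of "{1..l}" "F \<inter> {1..l}"] by (intro mult_right_mono) auto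
    also have "\<dots> \<le> real l powr p * (r / (2 * real l)) powr p"
      using powr_mono[of 1 p "real l"] p l(1) by (intro mult_right_mono) auto
    also have "\<dots> = (r/2) powr p"
      using l(1) r by (subst powr_mult[symmetric]) (auto simp: field_simps)
    also have "(r/2) powr p + (r/2) powr p = 2 powr 1 * (r/2) powr p" by simp
    also have "\<dots> \<le> 2 powr p * (r/2) powr p"
      using p by (intro mult_right_mono powr_mono) auto
    also have "\<dots> = r powr p" using r by (subst powr_mult[symmetric]) auto
    finally show "(\<Sum>k\<in>F. norm (?d k) powr p) \<le> r powr p" by simp
  qed (use r in simp)
  then show ?thesis using l(1) y(1) by blast
qed

lemma openin_frequent_returns:
  fixes f :: "nat \<Rightarrow> nat \<Rightarrow> nat" and w :: "nat \<Rightarrow> nat \<Rightarrow> 'k::real_normed_field"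
  assumes p: "1 \<le> p" and fw: "\<And>s. s \<in> {1..N} \<Longrightarrow> pseudo_shift_data (f s) (w s)"
    and z: "\<And>s. s \<in> {1..N} \<Longrightarrow> z s \<in> lp_space p" and J: "finite J"
  shows "openin (lp_topology p) {x \<in> lp_space p. c < real (card
     ({n. 1 \<le> n \<and> (\<forall>s\<in>{1..N}. lp_dist p (z s) ((pseudo_shift (f s) (w s) ^^ n) x) < \<eta>)} \<inter> J))}"
    (is "openin _ ?U")
proof -
  interpret Metric_space "lp_space p :: (nat \<Rightarrow> 'k) set" "lp_dist p" by (rule Metric_space_lp[OF p])
  let ?T = "\<lambda>s. pseudo_shift (f s) (w s)"
  let ?R = "\<lambda>x. {n. 1 \<le> n \<and> (\<forall>s\<in>{1..N}. lp_dist p (z s) ((?T s ^^ n) x) < \<eta>)}"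
  have "\<exists>r>0. mball x r \<subseteq> ?U" if x: "x \<in> ?U" for x
  proof -
    have xl: "x \<in> lp_space p" using x by simp
    have Tl: "(?T s ^^ n) u \<in> lp_space p" if "s \<in> {1..N}" "u \<in> lp_space p" for s n u
      using pseudo_shift_funpow_mem_lp[OF fw p] that by blast
    define stable where "stable s n r \<longleftrightarrow> r > 0 \<and>
      (\<forall>u\<in>mball x r. lp_dist p (z s) ((?T s ^^ n) u) < \<eta>)" for s n r
    have ex_stable: "\<exists>r. stable s n r"
      if s: "s \<in> {1..N}" and n: "n \<in> ?R x \<inter> J" for s n
    proof -
      obtain B where B: "B > 0" "\<forall>x\<in>lp_space p. \<forall>y\<in>lp_space p.
          lp_dist p ((?T s ^^ n) x) ((?T s ^^ n) y) \<le> B * lp_dist p x y"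
        using pseudo_shift_funpow_Lipschitz[OF fw[OF s] p] by blast
      define e where "e = \<eta> - lp_dist p (z s) ((?T s ^^ n) x)"
      have e: "e > 0" using s n by (auto simp: e_def)
      show ?thesis
        unfolding stable_def
      proof (intro exI[of _ "e / B"] conjI ballI)
        fix u assume u: "u \<in> mball x (e / B)"
        have "lp_dist p (z s) ((?T s ^^ n) u)
            \<le> lp_dist p (z s) ((?T s ^^ n) x) + lp_dist p ((?T s ^^ n) x) ((?T s ^^ n) u)"
          using s u by (intro triangle Tl z) auto
        also have "lp_dist p ((?T s ^^ n) x) ((?T s ^^ n) u) \<le> B * lp_dist p x u"
          using B u by auto
        also have "\<dots> < e" using u B by (simp add: field_simps)
        finally show "lp_dist p (z s) ((?T s ^^ n) u) < \<eta>" by (simp add: e_def)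
      qed (use e B in simp)
    qed
    define r where "r s n = (SOME r. stable s n r)" for s n
    have r: "stable s n (r s n)" if "s \<in> {1..N}" "n \<in> ?R x \<inter> J" for s n
      unfolding r_def by (rule someI_ex) (rule ex_stable[OF that])
    define Q where "Q = {1..N} \<times> (?R x \<inter> J)"
    define r0 where "r0 = Min (insert 1 ((\<lambda>(s, n). r s n) ` Q))"
    have fin: "finite Q" using J unfolding Q_def by blast
    have "0 < (\<lambda>(s, n). r s n) d" if "d \<in> Q" for d
      using that r unfolding Q_def stable_def by force
    then have "r0 > 0" unfolding r0_def using fin by (subst Min_gr_iff) auto
    moreover have "mball x r0 \<subseteq> ?U"
    proof
      fix u assume u: "u \<in> mball x r0"
      have "?R x \<inter> J \<subseteq> ?R u \<inter> J"
      proof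
        fix n assume n: "n \<in> ?R x \<inter> J"
        have "lp_dist p (z s) ((?T s ^^ n) u) < \<eta>" if s: "s \<in> {1..N}" for s
        proof -
          have "(s, n) \<in> Q" using s n unfolding Q_def by blast
          then have "r0 \<le> r s n" unfolding r0_def using fin by (intro Min_le) force+
          then have "u \<in> mball x (r s n)" using u by auto
          then show ?thesis using r[OF s n] unfolding stable_def by blast
        qed
        then show "n \<in> ?R u \<inter> J" using n by auto
      qed
      then have "card (?R x \<inter> J) \<le> card (?R u \<inter> J)" using J by (intro card_mono) auto
      then show "u \<in> ?U" using x u by auto
    qed
    ultimately show ?thesis by blast
  qed
  then show ?thesis unfolding openin_mtopology by auto
qed

text \<open>
  For a fixed target, having windows longer than \<open>m\<close> in which the return times have density above \<open>\<delta>\<close> is an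
  open condition on \<open>x\<close>, and it is dense as soon as \<open>\<delta>\<close> does not depend on the open set where \<open>x\<close> is
  sought. This is the feature of upper densities that replaces a simultaneous construction for all
  targets by a countable intersection.
\<close>

lemma disjoint_hypercyclic_of_uniform_return_density:
  fixes f :: "nat \<Rightarrow> nat \<Rightarrow> nat" and w :: "nat \<Rightarrow> nat \<Rightarrow> 'k::{real_normed_field,euclidean_space}"
  assumes p: "1 \<le> p" and fw: "\<And>s. s \<in> {1..N} \<Longrightarrow> pseudo_shift_data (f s) (w s)"
    and \<A>: "\<And>A. A \<in> \<A> \<longleftrightarrow> A \<subseteq> {1..} \<and> (\<exists>\<delta>>0. window_dense K \<delta> A)"
    and uniform: "\<And>l y \<eta>. \<lbrakk>1 \<le> l; \<forall>s\<in>{1..N}. \<forall>j\<in>{1..l}. y s j \<noteq> 0; 0 < \<eta>\<rbrakk> \<Longrightarrow>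
      \<exists>\<delta>>0. \<forall>x0\<in>lp_space p. \<forall>\<rho>>0. \<exists>x\<in>lp_space p. lp_dist p x0 x < \<rho> \<and> window_dense K \<delta>
        {n. 1 \<le> n \<and> (\<forall>s\<in>{1..N}.
           lp_dist p (truncate_seq l (y s)) ((pseudo_shift (f s) (w s) ^^ n) x) < \<eta>)}"
  shows "disjoint_hypercyclic (lp_topology p) \<A> N (\<lambda>s. pseudo_shift (f s) (w s))"
proof -
  interpret Metric_space "lp_space p :: (nat \<Rightarrow> 'k) set" "lp_dist p" by (rule Metric_space_lp[OF p])
  let ?T = "\<lambda>s. pseudo_shift (f s) (w s)"
  obtain D0 :: "'k set" where D0: "countable D0" "\<And>X. open X \<Longrightarrow> X \<noteq> {} \<Longrightarrow> \<exists>d\<in>D0. d \<in> X"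
    using countable_dense_exists[where 'a = 'k] by blast
  define D where "D = D0 - {0}"
  have D: "countable D" "0 \<notin> D" using D0 by (auto simp: D_def)
  have D_dense: "\<exists>d\<in>D. norm (z - d) < e" if "0 < e" for z :: 'k and e
  proof -
    have "ball z e \<noteq> {0}" using not_open_singleton[of "0::'k"] open_ball by metis
    moreover have "z \<in> ball z e" using that by simp
    ultimately have "ball z e - {0} \<noteq> {}" by blast
    then obtain d where "d \<in> D0" "d \<in> ball z e - {0}" using D0(2)[of "ball z e - {0}"] by auto
    then show ?thesis by (auto simp: D_def dist_norm)
  qed
  define I where "I = (SIGMA l:{1::nat..}. ({1..N} \<rightarrow>\<^sub>E ({1..l} \<rightarrow>\<^sub>E D)) \<times> {1::nat..})"
  have "countable ({1..N} \<rightarrow>\<^sub>E ({1..l::nat} \<rightarrow>\<^sub>E D))" for l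
    by (intro countable_PiE finite_atLeastAtMost D(1))
  then have I: "countable I" unfolding I_def by (intro countable_SIGMA countableI_type)
  define R where "R i x = (case i of (l, y, q) \<Rightarrow> {n. 1 \<le> n \<and> (\<forall>s\<in>{1..N}.
     lp_dist p (truncate_seq l (y s)) ((?T s ^^ n) x) < 1 / real q)})" for i :: "nat \<times> (nat \<Rightarrow> nat \<Rightarrow> 'k) \<times> nat" and x
  have "\<exists>\<delta>>0. \<forall>x0\<in>lp_space p. \<forall>\<rho>>0. \<exists>x\<in>lp_space p. lp_dist p x0 x < \<rho> \<and> window_dense K \<delta> (R i x)"
    if iI: "i \<in> I" for i
  proof -
    obtain l y q where i: "i = (l, y, q)" by (cases i)
    have "y s j \<in> D" if "s \<in> {1..N}" "j \<in> {1..l}" for s j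
      using iI that unfolding i I_def by (auto simp: PiE_iff)
    then have "1 \<le> l" "1 \<le> q" "\<forall>s\<in>{1..N}. \<forall>j\<in>{1..l}. y s j \<noteq> 0"
      using iI D(2) unfolding i I_def by force+
    then show ?thesis using uniform[of l y "1 / real q"] by (simp add: i R_def)
  qed
  then obtain \<delta> where \<delta>: "\<And>i. i \<in> I \<Longrightarrow> \<delta> i > 0"
    "\<And>i x0 \<rho>. \<lbrakk>i \<in> I; x0 \<in> lp_space p; \<rho> > 0\<rbrakk> \<Longrightarrow>
      \<exists>x\<in>lp_space p. lp_dist p x0 x < \<rho> \<and> window_dense K (\<delta> i) (R i x)"
    by metis
  define U where "U i m = {x \<in> lp_space p. \<exists>M\<ge>m. \<exists>k\<in>K. \<delta> i * real M < real (card (R i x \<inter> {k+1..k+M}))}"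
    for i and m :: nat
  have "mtopology closure_of (\<Inter>((\<lambda>(i, m). U i m) ` (I \<times> UNIV))) = lp_space p"
  proof (rule metric_Baire_category[OF mcomplete_lp[OF p]])
    show "countable ((\<lambda>(i, m). U i m) ` (I \<times> UNIV))" using I by auto
    fix V assume "V \<in> (\<lambda>(i, m). U i m) ` (I \<times> UNIV)"
    then obtain i m where im: "i \<in> I" "V = U i m" by auto
    obtain l y q where i: "i = (l, y, q)" by (cases i)
    have "U i m = (\<Union>M\<in>{m..}. \<Union>k\<in>K. {x \<in> lp_space p. \<delta> i * real M < real (card (R i x \<inter> {k+1..k+M}))})"
      by (auto simp: U_def)
    moreover have "openin mtopology {x \<in> lp_space p. \<delta> i * real M < real (card (R i x \<inter> {k+1..k+M}))}" for M k
      unfolding i R_def prod.case by (rule openin_frequent_returns[OF p fw truncate_seq_mem_lp]) auto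
    ultimately have "openin mtopology V" unfolding im(2) by (force intro!: openin_Union)
    moreover have "mtopology closure_of V = lp_space p"
    proof -
      have "\<exists>x\<in>V. x \<in> mball x0 \<rho>" if x0: "x0 \<in> lp_space p" "\<rho> > 0" for x0 \<rho>
      proof -
        obtain x where "x \<in> lp_space p" "lp_dist p x0 x < \<rho>" "window_dense K (\<delta> i) (R i x)"
          using \<delta>(2)[OF im(1) x0] by blast
        then show ?thesis using x0 im by (auto simp: U_def window_dense_def)
      qed
      then show ?thesis by (auto simp: metric_closure_of)
    qed
    ultimately show "openin mtopology V \<and> mtopology closure_of V = lp_space p" by blast
  qed
  moreover have "(\<lambda>_. 0) \<in> (lp_space p :: (nat \<Rightarrow> 'k) set)" by (simp add: finitely_supported_lp_space)
  ultimately have "(\<lambda>_. 0) \<in> mtopology closure_of (\<Inter>((\<lambda>(i, m). U i m) ` (I \<times> UNIV)))" by simp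
  then obtain x where "x \<in> (\<Inter>((\<lambda>(i, m). U i m) ` (I \<times> UNIV)))" "x \<in> mball (\<lambda>_. 0) 1"
    unfolding metric_closure_of using zero_less_one by blast
  then have x: "x \<in> lp_space p" "\<And>i m. i \<in> I \<Longrightarrow> x \<in> U i m" by auto
  have xd: "window_dense K (\<delta> i) (R i x)" if "i \<in> I" for i
    using x(2)[OF that] by (auto simp: U_def window_dense_def)
  have "{n. n \<ge> 1 \<and> (\<forall>s\<in>{1..N}. (?T s ^^ n) x \<in> V s)} \<in> \<A>"
    if V: "\<forall>s\<in>{1..N}. openin (lp_topology p) (V s) \<and> V s \<noteq> {}" for V
  proof -
    have "\<exists>v r. v \<in> lp_space p \<and> 0 < r \<and> mball v r \<subseteq> V s" if "s \<in> {1..N}" for s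
      using V that unfolding openin_mtopology by (meson all_not_in_conv subsetD)
    then obtain v r where v: "\<And>s. s \<in> {1..N} \<Longrightarrow> v s \<in> lp_space p \<and> 0 < r s \<and> mball (v s) (r s) \<subseteq> V s"
      by metis
    define r0 where "r0 = Min (insert 1 (r ` {1..N}))"
    have r0: "r0 > 0" unfolding r0_def using v by (subst Min_gr_iff) auto
    have r0_le: "r0 \<le> r s" if "s \<in> {1..N}" for s unfolding r0_def using that by (intro Min_le) auto
    obtain l y where l: "1 \<le> l" and y: "\<forall>s\<in>{1..N}. \<forall>j\<in>{1..l}. y s j \<in> D"
        "\<forall>s\<in>{1..N}. lp_dist p (v s) (truncate_seq l (y s)) \<le> r0 / 2"
      using lp_targets_dense[OF p, of N v "r0 / 2" D] v r0 D_dense by auto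
    define y' where "y' = (\<lambda>s\<in>{1..N}. \<lambda>j\<in>{1..l}. y s j)"
    have y': "truncate_seq l (y' s) = truncate_seq l (y s)" if "s \<in> {1..N}" for s
      using that by (auto simp: truncate_seq_def y'_def)
    obtain q where q: "1 \<le> q" "1 / real q < r0 / 2"
      using real_arch_inverse[of "r0 / 2"] r0 by (auto simp: inverse_eq_divide Suc_le_eq)
    have iI: "(l, y', q) \<in> I" using l q y by (auto simp: I_def y'_def)
    have "R (l, y', q) x \<subseteq> {n. n \<ge> 1 \<and> (\<forall>s\<in>{1..N}. (?T s ^^ n) x \<in> V s)}"
    proof
      fix n assume n: "n \<in> R (l, y', q) x"
      have "(?T s ^^ n) x \<in> V s" if s: "s \<in> {1..N}" for s
      proof -
        have Tl: "(?T s ^^ n) x \<in> lp_space p" by (rule pseudo_shift_funpow_mem_lp[OF fw[OF s] p x(1)])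
        have "lp_dist p (v s) ((?T s ^^ n) x)
            \<le> lp_dist p (v s) (truncate_seq l (y s)) + lp_dist p (truncate_seq l (y s)) ((?T s ^^ n) x)"
          using v[OF s] by (intro triangle truncate_seq_mem_lp Tl) auto
        also have "\<dots> < r0 / 2 + r0 / 2"
        proof (rule add_le_less_mono)
          have "lp_dist p (truncate_seq l (y' s)) ((?T s ^^ n) x) < 1 / real q"
            using n s by (simp add: R_def)
          then show "lp_dist p (truncate_seq l (y s)) ((?T s ^^ n) x) < r0 / 2"
            using q(2) y'[OF s] by simp
        qed (use y(2) s in blast)
        finally have "(?T s ^^ n) x \<in> mball (v s) (r s)" using r0_le[OF s] v[OF s] Tl by auto
        then show ?thesis using v[OF s] by blast
      qed
      then show "n \<in> {n. n \<ge> 1 \<and> (\<forall>s\<in>{1..N}. (?T s ^^ n) x \<in> V s)}" using n by (auto simp: R_def)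
    qed
    then show ?thesis using \<A> window_dense_mono[OF xd[OF iI]] \<delta>(1)[OF iI] by auto
  qed
  then show ?thesis unfolding disjoint_hypercyclic_def using x(1) by auto
qed

section \<open>The characterisation\<close>

text \<open>
  Thinning \<open>A\<close> so that the blocks \<open>f\<^sub>s\<^sup>m [l']\<close> with \<open>m \<in> A\<close> are disjoint also forces gaps longer than \<open>Q\<close> in
  \<open>A\<close> once \<open>[l']\<close> contains the first \<open>Q\<close> iterates of \<open>1\<close>.
\<close>

lemma large_gaps_of_disjoint_blocks:
  assumes fw: "pseudo_shift_data f w"
    and l': "\<And>i. i \<le> Q \<Longrightarrow> (f ^^ i) 1 \<le> l'"
    and disj: "(f ^^ m) ` {1..l'} \<inter> (f ^^ n) ` {1..l'} = {}" and "n < m"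
  shows "Q < m - n"
proof (rule ccontr)
  assume "\<not> Q < m - n"
  then have "(f ^^ (m - n)) 1 \<in> {1..l'}"
    using l'[of "m - n"] pseudo_shift_data_funpow_ge[OF fw, of 1 "m - n"] by auto
  then have "(f ^^ m) 1 \<in> (f ^^ n) ` {1..l'}"
    using funpow_diff[of n m f 1] \<open>n < m\<close> by (metis image_eqI less_imp_le)
  moreover have "1 \<in> {1..l'}" using l'[of 0] by simp
  ultimately show False using disj by blast
qed

lemma bounded_sums_tail_small:
  fixes c :: "nat \<Rightarrow> real"
  assumes nonneg: "\<And>n. 0 \<le> c n" and C: "\<And>F. finite F \<Longrightarrow> F \<subseteq> {1..} \<Longrightarrow> sum c F \<le> C" and "0 < e"
  shows "\<exists>Q. \<forall>F. finite F \<longrightarrow> F \<subseteq> {Q<..} \<longrightarrow> sum c F \<le> e"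
proof -
  have "summable (\<lambda>n. c (Suc n))"
  proof (rule summableI_nonneg_bounded)
    show "(\<Sum>i<n. c (Suc i)) \<le> C" for n
      using C[of "Suc ` {..<n}"] by (auto simp: sum.reindex)
  qed (rule nonneg)
  then have "summable c" by (simp add: summable_Suc_iff)
  then show ?thesis using summable_tail_small[OF _ nonneg \<open>0 < e\<close>] by (meson less_imp_le)
qed

lemma finite_family_tail_small:
  fixes c :: "'a \<Rightarrow> nat \<Rightarrow> real"
  assumes "finite S" and "\<And>i. i \<in> S \<Longrightarrow> \<exists>Q. \<forall>F. finite F \<longrightarrow> F \<subseteq> {Q<..} \<longrightarrow> sum (c i) F \<le> e"
  shows "\<exists>Q. \<forall>i\<in>S. \<forall>F. finite F \<longrightarrow> F \<subseteq> {Q<..} \<longrightarrow> sum (c i) F \<le> e"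
proof -
  obtain q where q: "\<And>i F. \<lbrakk>i \<in> S; finite F; F \<subseteq> {q i<..}\<rbrakk> \<Longrightarrow> sum (c i) F \<le> e"
    using assms(2) by metis
  have "q i \<le> sum q S" if "i \<in> S" for i using assms(1) that by (intro member_le_sum) auto
  then show ?thesis using q by (intro exI[of _ "sum q S"]) (meson greaterThan_subset_iff subset_trans)
qed

text \<open>
  The density of the return times comes from the set \<open>A\<close>, which is chosen for the target \<open>(l, y, \<eta>)\<close> alone. The
  open set around \<open>x0\<close> only determines how long an initial segment of \<open>A\<close> is discarded, and this
  costs no more than a factor \<open>2\<close> in the density.
\<close>

lemma uniform_return_density:
  fixes f :: "nat \<Rightarrow> nat \<Rightarrow> nat" and w y :: "nat \<Rightarrow> nat \<Rightarrow> 'k::real_normed_field"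
  assumes N: "1 \<le> N" and p: "1 \<le> p" and fw: "\<And>s. s \<in> {1..N} \<Longrightarrow> pseudo_shift_data (f s) (w s)"
    and \<A>: "\<And>A. A \<in> \<A> \<longleftrightarrow> A \<subseteq> {1..} \<and> (\<exists>\<delta>>0. window_dense K \<delta> A)"
    and regular: "almost_partition_regular \<A> N f"
    and nz: "\<And>s j n. s \<in> {1..N} \<Longrightarrow> 1 \<le> j \<Longrightarrow> weight_prod (f s) (w s) j n \<noteq> 0"
    and sums: "\<And>s j. s \<in> {1..N} \<Longrightarrow> 1 \<le> j \<Longrightarrow> \<exists>C. \<forall>F. finite F \<longrightarrow> F \<subseteq> {1..} \<longrightarrow>
        (\<Sum>n\<in>F. 1 / norm (weight_prod (f s) (w s) j n) powr p) \<le> C"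
    and l: "1 \<le> l" and y: "\<And>s j. s \<in> {1..N} \<Longrightarrow> j \<in> {1..l} \<Longrightarrow> y s j \<noteq> 0"
    and weights: "\<And>\<epsilon>. 0 < \<epsilon> \<Longrightarrow> \<exists>A\<in>\<A>. \<forall>s\<in>{1..N}. \<forall>t\<in>{1..N}. s \<noteq> t \<longrightarrow> (\<forall>n\<in>A.
        (\<forall>j\<in>{1..l}. \<forall>F. finite F \<longrightarrow> F \<subseteq> {m\<in>A. (f t ^^ m) j \<in> (f s ^^ n) ` {l<..}} \<longrightarrow>
           (\<Sum>m\<in>F. norm (weight_prod (f s) (w s) (iter_inv (f s) n ((f t ^^ m) j)) n) powr p
              / norm (weight_prod (f t) (w t) j m) powr p) \<le> \<epsilon>) \<and>
        (\<forall>i\<in>{1..l}. \<forall>j\<in>{1..l}. (f s ^^ n) i = (f t ^^ n) j \<longrightarrow>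
           norm (weight_prod (f s) (w s) i n / weight_prod (f t) (w t) j n - y s i / y t j) \<le> \<epsilon>))"
    and \<eta>: "0 < \<eta>"
  shows "\<exists>\<delta>>0. \<forall>x0\<in>lp_space p. \<forall>\<rho>>0. \<exists>x\<in>lp_space p. lp_dist p x0 x < \<rho> \<and> window_dense K \<delta>
        {n. 1 \<le> n \<and> (\<forall>s\<in>{1..N}.
           lp_dist p (truncate_seq l (y s)) ((pseudo_shift (f s) (w s) ^^ n) x) < \<eta>)}"
proof -
  interpret Metric_space "lp_space p :: (nat \<Rightarrow> 'k) set" "lp_dist p" by (rule Metric_space_lp[OF p])
  let ?W = "\<lambda>s. weight_prod (f s) (w s)"
  have tails: "\<exists>Q. \<forall>s\<in>{1..N}. \<forall>j\<in>{1..l}. \<forall>F. finite F \<longrightarrow> F \<subseteq> {Q<..} \<longrightarrow>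
      (\<Sum>n\<in>F. 1 / norm (?W s j n) powr p) \<le> e" if "0 < e" for e
  proof -
    have "\<exists>Q. \<forall>F. finite F \<longrightarrow> F \<subseteq> {Q<..} \<longrightarrow> (\<Sum>n\<in>F. 1 / norm (?W s j n) powr p) \<le> e"
      if sj: "s \<in> {1..N}" "j \<in> {1..l}" for s j
    proof -
      obtain C where "\<And>F. finite F \<Longrightarrow> F \<subseteq> {1..} \<Longrightarrow> (\<Sum>n\<in>F. 1 / norm (?W s j n) powr p) \<le> C"
        using sums[of s j] sj by auto
      then show ?thesis by (intro bounded_sums_tail_small[OF _ _ \<open>0 < e\<close>]) auto
    qed
    then have "\<exists>Q. \<forall>d\<in>{1..N} \<times> {1..l}. \<forall>F. finite F \<longrightarrow> F \<subseteq> {Q<..} \<longrightarrow>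
        (\<Sum>n\<in>F. 1 / norm (?W (fst d) (snd d) n) powr p) \<le> e"
      by (intro finite_family_tail_small) (auto simp only: mem_Times_iff finite_cartesian_product_iff finite_atLeastAtMost)
    then show ?thesis by simp
  qed
  define C where "C = 1 + (\<Sum>(s, j)\<in>{1..N} \<times> {1..l}. norm (y s j))"
  have C: "1 \<le> C" by (auto simp: C_def intro!: sum_nonneg)
  have yC: "norm (y s j) \<le> C" if "s \<in> {1..N}" "j \<in> {1..l}" for s j
    using member_le_sum[of "(s, j)" "{1..N} \<times> {1..l}" "\<lambda>(s, j). norm (y s j)"] that
    by (simp add: C_def split_beta)
  \<comment> \<open>the factor by which \<open>interpolating_vector\<close> multiplies the errors \<open>\<epsilon>\<close> and \<open>\<epsilon>'\<close>\<close>
  define B where "B = real (Suc N) * real l * C powr p"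
  have B: "0 < B" using C l by (simp add: B_def)
  define \<epsilon> where "\<epsilon> = min 1 ((\<eta> / 2) powr p / B)"
  have \<epsilon>: "0 < \<epsilon>" "\<epsilon> \<le> 1" "B * \<epsilon> \<le> (\<eta> / 2) powr p"
    using B \<eta> by (auto simp: \<epsilon>_def min_def field_simps)
  obtain Q where "\<forall>s\<in>{1..N}. \<forall>j\<in>{1..l}. \<forall>F. finite F \<longrightarrow> F \<subseteq> {Q<..} \<longrightarrow>
    (\<Sum>n\<in>F. 1 / norm (?W s j n) powr p) \<le> \<epsilon>"
    using tails[OF \<epsilon>(1)] ..
  then have Q: "(\<Sum>n\<in>F. 1 / norm (?W s j n) powr p) \<le> \<epsilon>"
    if "s \<in> {1..N}" "j \<in> {1..l}" "finite F" "F \<subseteq> {Q<..}" for s j F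
    using that by blast
  \<comment> \<open>\<open>[l']\<close> contains the first \<open>Q\<close> iterates of \<open>1\<close> under \<open>f\<^sub>1\<close>, which forces gaps longer than \<open>Q\<close>\<close>
  define l' where "l' = l + (\<Sum>i\<in>{..Q}. (f 1 ^^ i) 1)"
  have l': "l \<le> l'" "\<And>i. i \<le> Q \<Longrightarrow> (f 1 ^^ i) 1 \<le> l'"
    using member_le_sum[of _ "{..Q}" "\<lambda>i. (f 1 ^^ i) 1"] by (auto simp: l'_def trans_le_add2)
  obtain A0 where A0: "A0 \<in> \<A>"
    and cross: "\<And>s t j n F. \<lbrakk>s \<in> {1..N}; t \<in> {1..N}; s \<noteq> t; j \<in> {1..l}; n \<in> A0; finite F;
        F \<subseteq> {m\<in>A0. (f t ^^ m) j \<in> (f s ^^ n) ` {l<..}}\<rbrakk> \<Longrightarrow>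
        (\<Sum>m\<in>F. norm (?W s (iter_inv (f s) n ((f t ^^ m) j)) n) powr p / norm (?W t j m) powr p) \<le> \<epsilon>"
    and match: "\<And>s t i j n. \<lbrakk>s \<in> {1..N}; t \<in> {1..N}; s \<noteq> t; n \<in> A0; i \<in> {1..l}; j \<in> {1..l};
        (f s ^^ n) i = (f t ^^ n) j\<rbrakk> \<Longrightarrow> norm (?W s i n / ?W t j n - y s i / y t j) \<le> \<epsilon>"
    using weights[OF \<epsilon>(1)] by (elim bexE) blast
  obtain A where A: "A \<subseteq> A0" "A \<in> \<A>"
    and blocks: "\<And>m n s t. \<lbrakk>m \<in> A; n \<in> A; m \<noteq> n; s \<in> {1..N}; t \<in> {1..N}\<rbrakk> \<Longrightarrow>
      (f s ^^ m) ` {1..l'} \<inter> (f t ^^ n) ` {1..l'} = {}"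
    using regular A0 l l'(1) unfolding almost_partition_regular_def by (meson order_trans)
  obtain \<delta> where \<delta>: "0 < \<delta>" "window_dense K \<delta> A" and A1: "A \<subseteq> {1..}" using A(2) \<A> by blast
  have gap: "Q < m - n" if "m \<in> A" "n \<in> A" "n < m" for m n
    using N that by (intro large_gaps_of_disjoint_blocks[OF fw[of 1] l'(2) blocks]) auto
  show ?thesis
  proof (intro exI[of _ "\<delta> / 2"] conjI ballI allI impI)
    show "0 < \<delta> / 2" using \<delta> by simp
    fix x0 :: "nat \<Rightarrow> 'k" and \<rho> :: real
    assume x0: "x0 \<in> lp_space p" and \<rho>: "0 < \<rho>"
    define \<epsilon>' where "\<epsilon>' = (\<rho> / 4) powr p / B"
    have \<epsilon>': "0 < \<epsilon>'" using \<rho> B by (simp add: \<epsilon>'_def)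
    obtain Q' where "\<forall>s\<in>{1..N}. \<forall>j\<in>{1..l}. \<forall>F. finite F \<longrightarrow> F \<subseteq> {Q'<..} \<longrightarrow>
      (\<Sum>n\<in>F. 1 / norm (?W s j n) powr p) \<le> \<epsilon>'"
      using tails[OF \<epsilon>'] ..
    then have Q': "(\<Sum>n\<in>F. 1 / norm (?W s j n) powr p) \<le> \<epsilon>'"
      if "s \<in> {1..N}" "j \<in> {1..l}" "finite F" "F \<subseteq> {Q'<..}" for s j F
      using that by blast
    obtain L where L: "\<And>F. finite F \<Longrightarrow> F \<subseteq> {L<..} \<Longrightarrow> (\<Sum>j\<in>F. norm (x0 j) powr p) < (\<rho> / 4) powr p"
      using summable_tail_small[of "\<lambda>j. norm (x0 j) powr p" "(\<rho> / 4) powr p"] x0 \<rho>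
      by (auto simp: lp_space_def)
    define x0' where "x0' = truncate_seq L x0"
    have x0': "x0' \<in> lp_space p" by (simp add: x0'_def truncate_seq_mem_lp)
    have "lp_dist p x0 x0' \<le> \<rho> / 4"
      unfolding lp_dist_def
    proof (rule lp_boundI(2)[OF p])
      have x00: "x0 0 = 0" using x0 by (simp add: lp_space_def)
      then show "x0 0 - x0' 0 = 0" by (simp add: x0'_def truncate_seq_def)
      fix F :: "nat set" assume F: "finite F"
      have "(\<Sum>j\<in>F. norm (x0 j - x0' j) powr p) = (\<Sum>j\<in>F \<inter> {L<..}. norm (x0 j) powr p)"
        using F x00
        by (intro sum.mono_neutral_cong_right) (auto simp: x0'_def truncate_seq_def not_less Suc_le_eq)
      also have "\<dots> \<le> (\<rho> / 4) powr p" using L[of "F \<inter> {L<..}"] F by auto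
      finally show "(\<Sum>j\<in>F. norm (x0 j - x0' j) powr p) \<le> (\<rho> / 4) powr p" .
    qed (use \<rho> in simp)
    define m0 where "m0 = max L (Suc Q')"
    have "\<exists>x\<in>lp_space p. lp_dist p x0' x \<le> \<rho> / 4 \<and> (\<forall>n\<in>A \<inter> {m0..}. \<forall>s\<in>{1..N}.
        lp_dist p (truncate_seq l (y s)) ((pseudo_shift (f s) (w s) ^^ n) x) \<le> \<eta> / 2)"
    proof (rule interpolating_vector[OF p fw nz, where C = C and \<epsilon> = \<epsilon> and \<epsilon>' = \<epsilon>' and L = L])
      show "m = n" if "m \<in> A" "n \<in> A" "s \<in> {1..N}" "t \<in> {1..N}" "i \<in> {1..l}" "j \<in> {1..l}"
        "(f s ^^ m) i = (f t ^^ n) j" for m n s t i j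
      proof (rule ccontr)
        assume "m \<noteq> n"
        then have "(f s ^^ m) ` {1..l'} \<inter> (f t ^^ n) ` {1..l'} = {}" using that by (intro blocks)
        moreover have "i \<in> {1..l'}" "j \<in> {1..l'}" using that l'(1) by auto
        ultimately show False using that(7) by blast
      qed
      show "(\<Sum>m\<in>F. 1 / norm (?W s j (m - n)) powr p) \<le> \<epsilon>"
        if "s \<in> {1..N}" "j \<in> {1..l}" "n \<in> A" "finite F" "F \<subseteq> A \<inter> {n<..}" for s j n F
      proof -
        have "inj_on (\<lambda>m. m - n) F" using that(5) by (auto simp: inj_on_def)
        then have "(\<Sum>m\<in>F. 1 / norm (?W s j (m - n)) powr p)
            = (\<Sum>k\<in>(\<lambda>m. m - n) ` F. 1 / norm (?W s j k) powr p)"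
          by (simp add: sum.reindex)
        also have "\<dots> \<le> \<epsilon>" using that gap[of _ n] by (intro Q) auto
        finally show ?thesis .
      qed
      show "(\<Sum>m\<in>F. norm (?W s (iter_inv (f s) n ((f t ^^ m) j)) n) powr p / norm (?W t j m) powr p) \<le> \<epsilon>"
        if "s \<in> {1..N}" "t \<in> {1..N}" "s \<noteq> t" "j \<in> {1..l}" "n \<in> A" "finite F"
          "F \<subseteq> {m\<in>A. (f t ^^ m) j \<in> (f s ^^ n) ` {l<..}}" for s t j n F
        using that A(1) by (intro cross) auto
      show "norm (?W s i n / ?W t j n - y s i / y t j) \<le> \<epsilon>"
        if "s \<in> {1..N}" "t \<in> {1..N}" "s \<noteq> t" "n \<in> A" "i \<in> {1..l}" "j \<in> {1..l}"
          "(f s ^^ n) i = (f t ^^ n) j" for s t i j n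
        using that A(1) by (intro match) auto
      show "(\<Sum>m\<in>F. 1 / norm (?W s j m) powr p) \<le> \<epsilon>'"
        if "s \<in> {1..N}" "j \<in> {1..l}" "finite F" "F \<subseteq> A \<inter> {m0..}" for s j F
        using that by (intro Q') (auto simp: m0_def)
      show "real (Suc N) * real l * (C powr p * \<epsilon>) \<le> (\<eta> / 2) powr p"
        using \<epsilon>(3) by (simp add: B_def mult_ac)
      have "real N * real l * (C powr p * \<epsilon>') \<le> B * \<epsilon>'"
        unfolding B_def mult.assoc using \<epsilon>' by (intro mult_right_mono) auto
      also have "\<dots> = (\<rho> / 4) powr p" using B by (simp add: \<epsilon>'_def)
      finally show "real N * real l * (C powr p * \<epsilon>') \<le> (\<rho> / 4) powr p" .
    qed (use y yC C \<epsilon> x0' \<rho> \<eta> in \<open>auto simp: m0_def x0'_def truncate_seq_def\<close>)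
    then obtain x where x: "x \<in> lp_space p" "lp_dist p x0' x \<le> \<rho> / 4"
      "\<And>n s. n \<in> A \<inter> {m0..} \<Longrightarrow> s \<in> {1..N} \<Longrightarrow>
        lp_dist p (truncate_seq l (y s)) ((pseudo_shift (f s) (w s) ^^ n) x) \<le> \<eta> / 2"
      by blast
    have "lp_dist p x0 x < \<rho>"
      using triangle[OF x0 x0' x(1)] x(2) \<open>lp_dist p x0 x0' \<le> \<rho> / 4\<close> \<rho> by linarith
    moreover have "A \<inter> {m0..} \<subseteq> {n. 1 \<le> n \<and> (\<forall>s\<in>{1..N}.
        lp_dist p (truncate_seq l (y s)) ((pseudo_shift (f s) (w s) ^^ n) x) < \<eta>)}"
      using x(3) A1 \<eta> by fastforce
    then have "window_dense K (\<delta> / 2) {n. 1 \<le> n \<and> (\<forall>s\<in>{1..N}.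
        lp_dist p (truncate_seq l (y s)) ((pseudo_shift (f s) (w s) ^^ n) x) < \<eta>)}"
      using window_dense_remove_initial[OF \<delta>(2,1), of m0] by (rule_tac window_dense_mono) auto
    ultimately show "\<exists>x\<in>lp_space p. lp_dist p x0 x < \<rho> \<and> window_dense K (\<delta> / 2)
        {n. 1 \<le> n \<and> (\<forall>s\<in>{1..N}.
           lp_dist p (truncate_seq l (y s)) ((pseudo_shift (f s) (w s) ^^ n) x) < \<eta>)}"
      using x(1) by blast
  qed
qed

lemma disjoint_hypercyclic_returns:
  assumes "disjoint_hypercyclic (lp_topology p) \<A> N T" and p: "1 \<le> p"
  shows "\<exists>x\<in>lp_space p. \<forall>z r. (\<forall>s\<in>{1..N}. z s \<in> lp_space p) \<longrightarrow> 0 < r \<longrightarrow>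
    (\<exists>A\<in>\<A>. \<forall>n\<in>A. \<forall>s\<in>{1..N}. lp_dist p (z s) ((T s ^^ n) x) < r)"
proof -
  interpret Metric_space "lp_space p :: (nat \<Rightarrow> 'a) set" "lp_dist p" by (rule Metric_space_lp[OF p])
  obtain x where x: "x \<in> lp_space p"
    "\<And>V. \<forall>s\<in>{1..N}. openin (lp_topology p) (V s) \<and> V s \<noteq> {} \<Longrightarrow>
       {n. n \<ge> 1 \<and> (\<forall>s\<in>{1..N}. (T s ^^ n) x \<in> V s)} \<in> \<A>"
    using assms(1) unfolding disjoint_hypercyclic_def by auto
  have "\<exists>A\<in>\<A>. \<forall>n\<in>A. \<forall>s\<in>{1..N}. lp_dist p (z s) ((T s ^^ n) x) < r"
    if z: "\<forall>s\<in>{1..N}. z s \<in> lp_space p" and "0 < r" for z r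
  proof (rule bexI[OF _ x(2)[of "\<lambda>s. mball (z s) r"]])
    show "\<forall>s\<in>{1..N}. openin mtopology (mball (z s) r) \<and> mball (z s) r \<noteq> {}"
      using z \<open>0 < r\<close> centre_in_mball_iff by blast
  qed auto
  then show ?thesis using x(1) by blast
qed

theorem theorem3p5:
  fixes N :: nat and p :: real
    and f :: "nat \<Rightarrow> nat \<Rightarrow> nat"
    and w :: "nat \<Rightarrow> nat \<Rightarrow> 'k::{real_normed_field, euclidean_space}"
    and \<A> :: "nat set set"
  assumes "N \<ge> 2" and "p \<ge> 1"
    and "\<forall>s\<in>{1..N}. pseudo_shift_data (f s) (w s)"
    and "\<A> = family_uBd \<or> \<A> = family_ud"
    and "almost_partition_regular \<A> N f"
  shows "disjoint_hypercyclic (lp_topology p) \<A> N (\<lambda>s. pseudo_shift (f s) (w s)) \<longleftrightarrow>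
    (\<forall>j\<ge>1. \<forall>s\<in>{1..N}. (\<Sum>\<^sub>\<infinity>n\<in>{1..}. 1 / ennreal (norm (weight_prod (f s) (w s) j n) powr p)) < \<infinity>) \<and>
    (\<forall>l\<ge>1. \<forall>a :: nat \<Rightarrow> nat \<Rightarrow> 'k. \<forall>\<epsilon>>0.
       (\<forall>s\<in>{1..N}. \<forall>j\<in>{1..l}. a s j \<noteq> 0) \<longrightarrow>
       (\<exists>A\<in>\<A>. \<forall>s\<in>{1..N}. \<forall>t\<in>{1..N}. s \<noteq> t \<longrightarrow> (\<forall>n\<in>A.
          (\<forall>j\<in>{1..l}.
             (\<Sum>\<^sub>\<infinity>m\<in>{m\<in>A. (f t ^^ m) j \<in> (f s ^^ n) ` {l<..}}.
                ennreal (norm (weight_prod (f s) (w s) (iter_inv (f s) n ((f t ^^ m) j)) n) powr p)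
                / ennreal (norm (weight_prod (f t) (w t) j m) powr p)) \<le> ennreal \<epsilon>) \<and>
          (\<forall>j\<in>(f t ^^ n) ` {1..l} \<inter> (f s ^^ n) ` {1..l}.
             norm (weight_prod (f s) (w s) (iter_inv (f s) n j) n / weight_prod (f t) (w t) (iter_inv (f t) n j) n
                   - a s (iter_inv (f s) n j) / a t (iter_inv (f t) n j)) \<le> \<epsilon>))))"
    (is "?hyper \<longleftrightarrow> ?sums \<and> ?weights")
proof -
  let ?W = "\<lambda>s. weight_prod (f s) (w s)"
  note p = \<open>p \<ge> 1\<close>
  have fw: "pseudo_shift_data (f s) (w s)" if "s \<in> {1..N}" for s using assms(3) that by blast
  \<comment> \<open>the admissible starting points of windows for the family at hand\<close>
  define K where "K = (if \<A> = family_ud then {0} else {1::nat..})"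
  have \<A>: "A \<in> \<A> \<longleftrightarrow> A \<subseteq> {1..} \<and> (\<exists>\<delta>>0. window_dense K \<delta> A)" for A
    using assms(4) by (auto simp: K_def family_ud_iff_window_dense family_uBd_iff_window_dense)
  have Banach: "\<exists>\<delta>>0. window_dense {1..} \<delta> A" if A: "A \<in> \<A>" for A
  proof -
    obtain \<delta> where \<delta>: "\<delta> > 0" "window_dense K \<delta> A" using \<A> A by blast
    show ?thesis
    proof (cases "\<A> = family_ud")
      case True
      then have "window_dense {1..} (\<delta> / 2) A"
        using \<delta> by (intro window_dense_ud_imp_uBd) (simp_all add: K_def)
      then show ?thesis using half_gt_zero[OF \<delta>(1)] by blast
    next
      case False
      then show ?thesis using \<delta> by (auto simp: K_def)
    qed
  qed
  \<comment> \<open>For nonzero weights, both halves of (2) are statements about finite real sums and iterates, without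
    extended reals and inverses of iterates.\<close>
  have cross_iff: "(\<Sum>\<^sub>\<infinity>m\<in>{m\<in>A. (f t ^^ m) j \<in> (f s ^^ n) ` {l<..}}.
        ennreal (norm (?W s (iter_inv (f s) n ((f t ^^ m) j)) n) powr p)
        / ennreal (norm (?W t j m) powr p)) \<le> ennreal \<epsilon> \<longleftrightarrow>
      (\<forall>F. finite F \<longrightarrow> F \<subseteq> {m\<in>A. (f t ^^ m) j \<in> (f s ^^ n) ` {l<..}} \<longrightarrow>
        (\<Sum>m\<in>F. norm (?W s (iter_inv (f s) n ((f t ^^ m) j)) n) powr p / norm (?W t j m) powr p) \<le> \<epsilon>)"
    if "\<And>m. ?W t j m \<noteq> 0" "0 < \<epsilon>" for A s t j n l \<epsilon>
    using that by (intro infsum_ennreal_quotient_le_iff) auto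
  have match_iff: "(\<forall>j\<in>(f t ^^ n) ` {1..l} \<inter> (f s ^^ n) ` {1..l}.
        norm (?W s (iter_inv (f s) n j) n / ?W t (iter_inv (f t) n j) n
          - a s (iter_inv (f s) n j) / a t (iter_inv (f t) n j)) \<le> \<epsilon>) \<longleftrightarrow>
      (\<forall>i\<in>{1..l}. \<forall>j\<in>{1..l}. (f s ^^ n) i = (f t ^^ n) j \<longrightarrow>
        norm (?W s i n / ?W t j n - a s i / a t j) \<le> \<epsilon>)" (is "?l \<longleftrightarrow> ?r")
    if st: "s \<in> {1..N}" "t \<in> {1..N}" for s t n l \<epsilon> and a :: "nat \<Rightarrow> nat \<Rightarrow> 'k"
  proof -
    have inv: "iter_inv (f u) n ((f u ^^ n) i) = i" if "u \<in> {1..N}" "i \<in> {1..l}" for u i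
      using iter_inv_funpow[OF fw] that by simp
    show ?thesis
    proof
      assume L: ?l
      show ?r
      proof (intro ballI impI)
        fix i j assume ij: "i \<in> {1..l}" "j \<in> {1..l}" "(f s ^^ n) i = (f t ^^ n) j"
        then have "(f s ^^ n) i \<in> (f t ^^ n) ` {1..l} \<inter> (f s ^^ n) ` {1..l}" by blast
        with L show "norm (?W s i n / ?W t j n - a s i / a t j) \<le> \<epsilon>"
          using inv[OF st(1) ij(1)] inv[OF st(2) ij(2)] ij(3) by metis
      qed
    next
      assume R: ?r
      show ?l
      proof
        fix q assume "q \<in> (f t ^^ n) ` {1..l} \<inter> (f s ^^ n) ` {1..l}"
        then obtain i j where "i \<in> {1..l}" "j \<in> {1..l}" "q = (f s ^^ n) i" "q = (f t ^^ n) j" by blast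
        then show "norm (?W s (iter_inv (f s) n q) n / ?W t (iter_inv (f t) n q) n
          - a s (iter_inv (f s) n q) / a t (iter_inv (f t) n q)) \<le> \<epsilon>"
          using R inv st by metis
      qed
    qed
  qed
  have sums_iff: "(\<Sum>\<^sub>\<infinity>n\<in>{1..}. 1 / ennreal (norm (?W s j n) powr p)) < \<infinity> \<longleftrightarrow>
      (\<forall>n. ?W s j n \<noteq> 0) \<and> (\<exists>C\<ge>0. \<forall>F. finite F \<longrightarrow> F \<subseteq> {1..} \<longrightarrow> (\<Sum>n\<in>F. 1 / norm (?W s j n) powr p) \<le> C)"
    for s j
  proof -
    have "(\<forall>n\<in>{1..}. 0 < norm (?W s j n) powr p) \<longleftrightarrow> (\<forall>n. ?W s j n \<noteq> 0)"
    proof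
      assume H: "\<forall>n\<in>{1..}. 0 < norm (?W s j n) powr p"
      show "\<forall>n. ?W s j n \<noteq> 0"
      proof
        fix n show "?W s j n \<noteq> 0" using H by (cases "n = 0") auto
      qed
    qed auto
    then show ?thesis
      using infsum_ennreal_inverse_finite_iff[of "{1..}" "\<lambda>n. norm (?W s j n) powr p"] by simp
  qed
  show ?thesis
  proof
    assume ?hyper
    then obtain x where x: "x \<in> lp_space p"
      and returns: "\<forall>z r. (\<forall>s\<in>{1..N}. z s \<in> lp_space p) \<longrightarrow> 0 < r \<longrightarrow>
        (\<exists>A\<in>\<A>. \<forall>n\<in>A. \<forall>s\<in>{1..N}. lp_dist p (z s) ((pseudo_shift (f s) (w s) ^^ n) x) < r)"
      by (rule bexE[OF disjoint_hypercyclic_returns[OF _ p]])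
    have ret: "\<exists>A\<in>\<A>. \<forall>n\<in>A. \<forall>s\<in>{1..N}. lp_dist p (z s) ((pseudo_shift (f s) (w s) ^^ n) x) < r"
      if "\<forall>s\<in>{1..N}. z s \<in> lp_space p" "0 < r" for z r
      using returns[THEN spec, THEN spec, THEN mp, THEN mp, OF that] .
    have nz_bdd: "(\<forall>n. ?W s j n \<noteq> 0) \<and> (\<exists>B. \<forall>K. (\<Sum>k\<in>{1..K}. 1 / norm (?W s j k) powr p) \<le> B)"
      if s: "s \<in> {1..N}" and j: "1 \<le> j" for s j
    proof -
      \<comment> \<open>any target whose \<open>j\<close>-th entry is larger than the radius would do\<close>
      let ?z = "truncate_seq j (\<lambda>_. 1) :: nat \<Rightarrow> 'k"
      have z: "?z \<in> lp_space p" by (rule truncate_seq_mem_lp)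
      obtain A where A: "A \<in> \<A>"
        "\<And>n. n \<in> A \<Longrightarrow> lp_dist p ?z ((pseudo_shift (f s) (w s) ^^ n) x) < 1/2"
        using ret[of "\<lambda>_. ?z" "1/2"] z s by auto
      obtain \<delta> where "\<delta> > 0" "window_dense {1..} \<delta> A" using Banach[OF A(1)] by blast
      moreover have "1/2 < norm (?z j)" using j by (simp add: truncate_seq_def)
      ultimately show ?thesis
        using weight_inverse_sums_bounded_of_returns[OF fw[OF s] p x z _ _ A(2) j] by blast
    qed
    have ?sums
    proof (intro allI impI ballI)
      fix j s :: nat assume js: "1 \<le> j" "s \<in> {1..N}"
      obtain B where B: "\<And>K. (\<Sum>k\<in>{1..K}. 1 / norm (?W s j k) powr p) \<le> B"
        using nz_bdd[OF js(2,1)] by blast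
      have "(\<Sum>n\<in>F. 1 / norm (?W s j n) powr p) \<le> B" if F: "finite F" "F \<subseteq> {1..}" for F
      proof -
        have "F \<subseteq> {1..Max (insert 1 F)}" using F by (auto intro: Max_ge)
        then have "(\<Sum>n\<in>F. 1 / norm (?W s j n) powr p)
            \<le> (\<Sum>n\<in>{1..Max (insert 1 F)}. 1 / norm (?W s j n) powr p)"
          by (intro sum_mono2) auto
        then show ?thesis using B order_trans by blast
      qed
      moreover have "0 \<le> B" using B[of 0] by simp
      ultimately show "(\<Sum>\<^sub>\<infinity>n\<in>{1..}. 1 / ennreal (norm (?W s j n) powr p)) < \<infinity>"
        using nz_bdd[OF js(2,1)] unfolding sums_iff by blast
    qed
    moreover have ?weights
    proof (intro allI impI)
      fix l :: nat and a :: "nat \<Rightarrow> nat \<Rightarrow> 'k" and \<epsilon> :: real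
      assume l: "1 \<le> l" and \<epsilon>: "0 < \<epsilon>" and a: "\<forall>s\<in>{1..N}. \<forall>j\<in>{1..l}. a s j \<noteq> 0"
      define S where "S = (\<lambda>(s, j). norm (a s j)) ` ({1..N} \<times> {1..l})"
      have S: "finite S" "S \<noteq> {}" "\<And>s j. s \<in> {1..N} \<Longrightarrow> j \<in> {1..l} \<Longrightarrow> norm (a s j) \<in> S"
        using l \<open>N \<ge> 2\<close> by (auto simp: S_def)
      define \<alpha> where "\<alpha> = Min S"
      define \<beta> where "\<beta> = Max S"
      have \<alpha>\<beta>: "\<alpha> \<le> norm (a s j) \<and> norm (a s j) \<le> \<beta>" if "s \<in> {1..N}" "j \<in> {1..l}" for s j
        using S that by (auto simp: \<alpha>_def \<beta>_def)
      have "\<forall>b\<in>S. 0 < b" using a by (auto simp: S_def)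
      then have \<alpha>: "0 < \<alpha>" "0 < \<beta>" using S by (auto simp: \<alpha>_def \<beta>_def)
      define r where "r = Min {\<alpha> / 2, \<alpha> * \<epsilon> / 2, \<epsilon> * \<alpha>\<^sup>2 / (4 * \<beta>)}"
      have r: "0 < r" "2 * r \<le> \<alpha>" "2 * r \<le> \<alpha> * \<epsilon>" "4 * r * \<beta> \<le> \<epsilon> * \<alpha>\<^sup>2"
      proof -
        have "r \<le> \<epsilon> * \<alpha>\<^sup>2 / (4 * \<beta>)" unfolding r_def by (rule Min_le) auto
        then show "4 * r * \<beta> \<le> \<epsilon> * \<alpha>\<^sup>2" using \<alpha> by (simp add: field_simps)
      qed (use \<alpha> \<epsilon> in \<open>auto simp: r_def\<close>)
      obtain A where A: "A \<in> \<A>" "\<And>n s. n \<in> A \<Longrightarrow> s \<in> {1..N} \<Longrightarrow>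
          lp_dist p (truncate_seq l (a s)) ((pseudo_shift (f s) (w s) ^^ n) x) < r"
        using ret[of "\<lambda>s. truncate_seq l (a s)" r] r(1) truncate_seq_mem_lp by blast
      show "\<exists>A\<in>\<A>. \<forall>s\<in>{1..N}. \<forall>t\<in>{1..N}. s \<noteq> t \<longrightarrow> (\<forall>n\<in>A.
          (\<forall>j\<in>{1..l}.
             (\<Sum>\<^sub>\<infinity>m\<in>{m\<in>A. (f t ^^ m) j \<in> (f s ^^ n) ` {l<..}}.
                ennreal (norm (?W s (iter_inv (f s) n ((f t ^^ m) j)) n) powr p)
                / ennreal (norm (?W t j m) powr p)) \<le> ennreal \<epsilon>) \<and>
          (\<forall>j\<in>(f t ^^ n) ` {1..l} \<inter> (f s ^^ n) ` {1..l}.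
             norm (?W s (iter_inv (f s) n j) n / ?W t (iter_inv (f t) n j) n
                   - a s (iter_inv (f s) n j) / a t (iter_inv (f t) n j)) \<le> \<epsilon>))"
      proof (intro bexI[OF _ A(1)] ballI impI)
        fix s t n assume st: "s \<in> {1..N}" "t \<in> {1..N}" and n: "n \<in> A"
        have nzt: "?W t j m \<noteq> 0" if "1 \<le> j" for j m using nz_bdd[OF st(2) that] by blast
        have le: "lp_dist p (truncate_seq l (a u)) ((pseudo_shift (f u) (w u) ^^ n) x) \<le> r"
          if "u \<in> {s, t}" "n \<in> A" for u n using A(2)[of n u] st that by auto
        have \<alpha>\<beta>': "\<alpha> \<le> norm (a u j) \<and> norm (a u j) \<le> \<beta>" if "u \<in> {s, t}" "j \<in> {1..l}" for u j
          using \<alpha>\<beta> st that by blast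
        note conds = weight_conditions_of_returns[OF p x fw[OF st(1)] fw[OF st(2)] nzt le \<alpha>\<beta>' \<alpha>(1)
            less_imp_le[OF r(1)] r(2,3,4) n]
        have "\<forall>j\<in>{1..l}. (\<Sum>\<^sub>\<infinity>m\<in>{m\<in>A. (f t ^^ m) j \<in> (f s ^^ n) ` {l<..}}.
                ennreal (norm (?W s (iter_inv (f s) n ((f t ^^ m) j)) n) powr p)
                / ennreal (norm (?W t j m) powr p)) \<le> ennreal \<epsilon>"
        proof
          fix j assume j: "j \<in> {1..l}"
          show "(\<Sum>\<^sub>\<infinity>m\<in>{m\<in>A. (f t ^^ m) j \<in> (f s ^^ n) ` {l<..}}.
                ennreal (norm (?W s (iter_inv (f s) n ((f t ^^ m) j)) n) powr p)
                / ennreal (norm (?W t j m) powr p)) \<le> ennreal \<epsilon>"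
            using j nzt[of j] \<epsilon> by (subst cross_iff) (auto intro!: conds(1))
        qed
        moreover have "\<forall>j\<in>(f t ^^ n) ` {1..l} \<inter> (f s ^^ n) ` {1..l}.
             norm (?W s (iter_inv (f s) n j) n / ?W t (iter_inv (f t) n j) n
                   - a s (iter_inv (f s) n j) / a t (iter_inv (f t) n j)) \<le> \<epsilon>"
          unfolding match_iff[OF st] using conds(2) by blast
        ultimately show "(\<forall>j\<in>{1..l}. (\<Sum>\<^sub>\<infinity>m\<in>{m\<in>A. (f t ^^ m) j \<in> (f s ^^ n) ` {l<..}}.
                ennreal (norm (?W s (iter_inv (f s) n ((f t ^^ m) j)) n) powr p)
                / ennreal (norm (?W t j m) powr p)) \<le> ennreal \<epsilon>) \<and>
          (\<forall>j\<in>(f t ^^ n) ` {1..l} \<inter> (f s ^^ n) ` {1..l}.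
             norm (?W s (iter_inv (f s) n j) n / ?W t (iter_inv (f t) n j) n
                   - a s (iter_inv (f s) n j) / a t (iter_inv (f t) n j)) \<le> \<epsilon>)" by blast
      qed
    qed
    ultimately show "?sums \<and> ?weights" ..
  next
    assume cond: "?sums \<and> ?weights"
    have "(\<forall>n. ?W s j n \<noteq> 0) \<and>
        (\<exists>C\<ge>0. \<forall>F. finite F \<longrightarrow> F \<subseteq> {1..} \<longrightarrow> (\<Sum>n\<in>F. 1 / norm (?W s j n) powr p) \<le> C)"
      if sj: "s \<in> {1..N}" "1 \<le> j" for s j
      using conjunct1[OF cond, THEN spec, THEN mp, OF sj(2), THEN bspec, OF sj(1)] unfolding sums_iff .
    then have nz: "?W s j n \<noteq> 0"
      and bdd: "\<exists>C. \<forall>F. finite F \<longrightarrow> F \<subseteq> {1..} \<longrightarrow> (\<Sum>n\<in>F. 1 / norm (?W s j n) powr p) \<le> C"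
      if "s \<in> {1..N}" "1 \<le> j" for s j n
      using that by blast+
    show ?hyper
    proof (rule disjoint_hypercyclic_of_uniform_return_density[OF p fw \<A>])
      fix l and y :: "nat \<Rightarrow> nat \<Rightarrow> 'k" and \<eta> :: real
      assume l: "1 \<le> l" and y: "\<forall>s\<in>{1..N}. \<forall>j\<in>{1..l}. y s j \<noteq> 0" and \<eta>: "0 < \<eta>"
      show "\<exists>\<delta>>0. \<forall>x0\<in>lp_space p. \<forall>\<rho>>0. \<exists>x\<in>lp_space p. lp_dist p x0 x < \<rho> \<and> window_dense K \<delta>
        {n. 1 \<le> n \<and> (\<forall>s\<in>{1..N}.
           lp_dist p (truncate_seq l (y s)) ((pseudo_shift (f s) (w s) ^^ n) x) < \<eta>)}"
      proof (rule uniform_return_density[OF _ p fw \<A> assms(5) nz bdd l _ _ \<eta>])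
        fix \<epsilon> :: real assume \<epsilon>: "0 < \<epsilon>"
        obtain A where A: "A \<in> \<A>" "\<forall>s\<in>{1..N}. \<forall>t\<in>{1..N}. s \<noteq> t \<longrightarrow> (\<forall>n\<in>A.
          (\<forall>j\<in>{1..l}.
             (\<Sum>\<^sub>\<infinity>m\<in>{m\<in>A. (f t ^^ m) j \<in> (f s ^^ n) ` {l<..}}.
                ennreal (norm (?W s (iter_inv (f s) n ((f t ^^ m) j)) n) powr p)
                / ennreal (norm (?W t j m) powr p)) \<le> ennreal \<epsilon>) \<and>
          (\<forall>j\<in>(f t ^^ n) ` {1..l} \<inter> (f s ^^ n) ` {1..l}.
             norm (?W s (iter_inv (f s) n j) n / ?W t (iter_inv (f t) n j) n
                   - y s (iter_inv (f s) n j) / y t (iter_inv (f t) n j)) \<le> \<epsilon>))"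
          by (rule bexE[OF conjunct2[OF cond, THEN spec, THEN mp, OF l, THEN spec, THEN spec, THEN mp, OF \<epsilon>,
            THEN mp, OF y]])
        show "\<exists>A\<in>\<A>. \<forall>s\<in>{1..N}. \<forall>t\<in>{1..N}. s \<noteq> t \<longrightarrow> (\<forall>n\<in>A.
          (\<forall>j\<in>{1..l}. \<forall>F. finite F \<longrightarrow> F \<subseteq> {m\<in>A. (f t ^^ m) j \<in> (f s ^^ n) ` {l<..}} \<longrightarrow>
             (\<Sum>m\<in>F. norm (?W s (iter_inv (f s) n ((f t ^^ m) j)) n) powr p / norm (?W t j m) powr p) \<le> \<epsilon>) \<and>
          (\<forall>i\<in>{1..l}. \<forall>j\<in>{1..l}. (f s ^^ n) i = (f t ^^ n) j \<longrightarrow>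
             norm (?W s i n / ?W t j n - y s i / y t j) \<le> \<epsilon>))"
        proof (intro bexI[OF _ A(1)] ballI impI conjI)
          fix s t n assume st: "s \<in> {1..N}" "t \<in> {1..N}" "s \<noteq> t" and n: "n \<in> A"
          note A_n = A(2)[THEN bspec, OF st(1), THEN bspec, OF st(2), THEN mp, OF st(3), THEN bspec, OF n]
          show "\<forall>F. finite F \<longrightarrow> F \<subseteq> {m\<in>A. (f t ^^ m) j \<in> (f s ^^ n) ` {l<..}} \<longrightarrow>
             (\<Sum>m\<in>F. norm (?W s (iter_inv (f s) n ((f t ^^ m) j)) n) powr p / norm (?W t j m) powr p) \<le> \<epsilon>"
            if "j \<in> {1..l}" for j
            using conjunct1[OF A_n] that nz[OF st(2)] \<epsilon> by (subst cross_iff[symmetric]) auto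
          show "norm (?W s i n / ?W t j n - y s i / y t j) \<le> \<epsilon>"
            if "i \<in> {1..l}" "j \<in> {1..l}" "(f s ^^ n) i = (f t ^^ n) j" for i j
            using conjunct2[OF A_n] that unfolding match_iff[OF st(1,2)] by blast
        qed
      qed (use y \<open>N \<ge> 2\<close> in auto)
    qed
  qed
qed

end
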